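(* For every $\mathcal L_{\mathsf{ID}}$-formula $\psi$: if $\Pi^1_1\text{-}\mathsf{CA}_0^-+\{\operatorname{LF}_\varphi(Y_\varphi)\mid\varphi\text{ an operator form}\}\vdash\psi^\star$, then $\mathsf{ID}_1\vdash\psi$.
   Context: Formulas are in negation normal form (built from literals by $\land,\lor,\forall,\exists$; $\neg$ and $\to$ are abbreviations via de Morgan laws). $\mathcal L_{\mathsf{PA}}^X$ is the language of first order arithmetic with an extra unary predicate $X$. An operator form is an $\mathcal L^X_{\mathsf{PA}}$-formula $\varphi(x,X)$ with a single free number variable $x$ and no subformula of the form $\neg Xt$. $\mathcal L_{\mathsf{ID}}$ extends $\mathcal L_{\mathsf{PA}}$ by a unary predicate $I_\varphi$ for each operator form $\varphi$; $\varphi(x,\psi)$ denotes the result of replacing each $Xt$ in $\varphi$ by $\psi(t)$, and $\varphi(x,I_\varphi)$ that of replacing $Xt$ by $I_\varphi t$. $\mathsf{ID}_1$ is the $\mathcal L_{\mathsf{ID}}$-theory consisting of Peano arithmetic with equality and induction axioms for all $\mathcal L_{\mathsf{ID}}$-formulas, plus the schemata (F) $\forall x(\varphi(x,I_\varphi)\to I_\varphi x)$ and (L) $\forall x(\varphi(x,\psi)\to\psi(x))\to\forall x(I_\varphi x\to\psi(x))$ for operator forms $\varphi$ and $\mathcal L_{\mathsf{ID}}$-formulas $\psi$. $\Pi^1_1\text{-}\mathsf{CA}_0^-$ is $\mathsf{ACA}_0$ plus comprehension for all $\Pi^1_1$-formulas without free set variables (number parameters allowed). Viewing $X$ as a set variable,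 operator forms are $\mathcal L_2$-formulas; $\operatorname{Cl}_\varphi(X):=\forall x\in\mathbb N(\varphi(x,X)\to x\in X)$ and $\operatorname{LF}_\varphi(Y):=\forall x\in\mathbb N\,(x\in Y\leftrightarrow\forall X\subseteq\mathbb N(\operatorname{Cl}_\varphi(X)\to x\in X))$. To each operator form $\varphi$ a fixed set variable $Y_\varphi$ is associated, and $\psi^\star$ is obtained from an $\mathcal L_{\mathsf{ID}}$-formula $\psi$ by replacing each $I_\varphi t$ by $t\in Y_\varphi$. *)

theory Defs
  imports Main "HOL-Library.Countable"
begin

text \<open>
  Variables are de Bruijn indices. In a formula used as a predicate \<open>\<psi>(x)\<close>, the
  distinguished variable \<open>x\<close> is the free number variable 0 and the free variables
  1, 2, ... are parameters. Formulas are in negation normal form; negation is a function on formulas.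
\<close>

datatype tm = Var nat | Zero | Succ tm | Add tm tm | Mul tm tm

primrec fv_tm :: "tm \<Rightarrow> nat set" where
  "fv_tm (Var n) = {n}"
| "fv_tm Zero = {}"
| "fv_tm (Succ t) = fv_tm t"
| "fv_tm (Add s t) = fv_tm s \<union> fv_tm t"
| "fv_tm (Mul s t) = fv_tm s \<union> fv_tm t"

primrec subst_tm :: "(nat \<Rightarrow> tm) \<Rightarrow> tm \<Rightarrow> tm" where
  "subst_tm \<sigma> (Var n) = \<sigma> n"
| "subst_tm \<sigma> Zero = Zero"
| "subst_tm \<sigma> (Succ t) = Succ (subst_tm \<sigma> t)"
| "subst_tm \<sigma> (Add s t) = Add (subst_tm \<sigma> s) (subst_tm \<sigma> t)"
| "subst_tm \<sigma> (Mul s t) = Mul (subst_tm \<sigma> s) (subst_tm \<sigma> t)"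

text \<open>The substitution \<open>\<sigma>\<close> pushed under one number quantifier.\<close>

definition lift_sub :: "(nat \<Rightarrow> tm) \<Rightarrow> nat \<Rightarrow> tm" where
  "lift_sub \<sigma> = case_nat (Var 0) (\<lambda>k. subst_tm (\<lambda>i. Var (Suc i)) (\<sigma> k))"


section \<open>First order arithmetic with unary predicate symbols\<close>

text \<open>
  The type \<open>'p\<close> is the set of extra unary predicate symbols: \<open>unit fm\<close> is the language
  of arithmetic with one extra predicate \<open>X\<close>.
\<close>

datatype 'p fm =
    Eq tm tm | Neq tm tm
  | Less tm tm | NLess tm tm
  | Pred 'p tm | NPred 'p tm
  | Conj "'p fm" "'p fm" | Disj "'p fm" "'p fm"
  | Forall "'p fm" | Exists "'p fm"

primrec neg :: "'p fm \<Rightarrow> 'p fm" where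
  "neg (Eq s t) = Neq s t"
| "neg (Neq s t) = Eq s t"
| "neg (Less s t) = NLess s t"
| "neg (NLess s t) = Less s t"
| "neg (Pred p t) = NPred p t"
| "neg (NPred p t) = Pred p t"
| "neg (Conj A B) = Disj (neg A) (neg B)"
| "neg (Disj A B) = Conj (neg A) (neg B)"
| "neg (Forall A) = Exists (neg A)"
| "neg (Exists A) = Forall (neg A)"

definition Imp :: "'p fm \<Rightarrow> 'p fm \<Rightarrow> 'p fm" where
  "Imp A B = Disj (neg A) B"

definition Iff :: "'p fm \<Rightarrow> 'p fm \<Rightarrow> 'p fm" where
  "Iff A B = Conj (Imp A B) (Imp B A)"

primrec fv :: "'p fm \<Rightarrow> nat set" where
  "fv (Eq s t) = fv_tm s \<union> fv_tm t"
| "fv (Neq s t) = fv_tm s \<union> fv_tm t"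
| "fv (Less s t) = fv_tm s \<union> fv_tm t"
| "fv (NLess s t) = fv_tm s \<union> fv_tm t"
| "fv (Pred p t) = fv_tm t"
| "fv (NPred p t) = fv_tm t"
| "fv (Conj A B) = fv A \<union> fv B"
| "fv (Disj A B) = fv A \<union> fv B"
| "fv (Forall A) = {n. Suc n \<in> fv A}"
| "fv (Exists A) = {n. Suc n \<in> fv A}"

primrec subst :: "(nat \<Rightarrow> tm) \<Rightarrow> 'p fm \<Rightarrow> 'p fm" where
  "subst \<sigma> (Eq s t) = Eq (subst_tm \<sigma> s) (subst_tm \<sigma> t)"
| "subst \<sigma> (Neq s t) = Neq (subst_tm \<sigma> s) (subst_tm \<sigma> t)"
| "subst \<sigma> (Less s t) = Less (subst_tm \<sigma> s) (subst_tm \<sigma> t)"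
| "subst \<sigma> (NLess s t) = NLess (subst_tm \<sigma> s) (subst_tm \<sigma> t)"
| "subst \<sigma> (Pred p t) = Pred p (subst_tm \<sigma> t)"
| "subst \<sigma> (NPred p t) = NPred p (subst_tm \<sigma> t)"
| "subst \<sigma> (Conj A B) = Conj (subst \<sigma> A) (subst \<sigma> B)"
| "subst \<sigma> (Disj A B) = Disj (subst \<sigma> A) (subst \<sigma> B)"
| "subst \<sigma> (Forall A) = Forall (subst (lift_sub \<sigma>) A)"
| "subst \<sigma> (Exists A) = Exists (subst (lift_sub \<sigma>) A)"

definition shift :: "'p fm \<Rightarrow> 'p fm" where
  "shift = subst (\<lambda>i. Var (Suc i))"

text \<open>Instantiation of variable 0 (the variable of a removed quantifier) by \<open>t\<close>.\<close>

definition inst :: "tm \<Rightarrow> 'p fm \<Rightarrow> 'p fm" where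
  "inst t = subst (case_nat t Var)"

definition univ_closure :: "'p fm \<Rightarrow> 'p fm" where
  "univ_closure A = (Forall ^^ (LEAST n. \<forall>k\<in>fv A. k < n)) A"

text \<open>
  One-sided (Tait style) sequent calculus for classical first order logic with equality; a sequent
  is read as the disjunction of its members. In the rule for \<open>Forall\<close> the eigenvariable is
  index 0, which is fresh for the shifted context.
\<close>

inductive tait :: "'p fm set \<Rightarrow> bool" where
  Ax: "A \<in> \<Gamma> \<Longrightarrow> neg A \<in> \<Gamma> \<Longrightarrow> tait \<Gamma>"
| EqRefl: "Eq t t \<in> \<Gamma> \<Longrightarrow> tait \<Gamma>"
| EqSubst: "Neq s t \<in> \<Gamma> \<Longrightarrow> neg (inst s A) \<in> \<Gamma> \<Longrightarrow> inst t A \<in> \<Gamma> \<Longrightarrow> tait \<Gamma>"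
| ConjR: "tait (insert A \<Gamma>) \<Longrightarrow> tait (insert B \<Gamma>) \<Longrightarrow> tait (insert (Conj A B) \<Gamma>)"
| DisjR: "tait (insert A (insert B \<Gamma>)) \<Longrightarrow> tait (insert (Disj A B) \<Gamma>)"
| ForallR: "tait (insert A (shift ` \<Gamma>)) \<Longrightarrow> tait (insert (Forall A) \<Gamma>)"
| ExistsR: "tait (insert (inst t A) \<Gamma>) \<Longrightarrow> tait (insert (Exists A) \<Gamma>)"
| Cut: "tait (insert A \<Gamma>) \<Longrightarrow> tait (insert (neg A) \<Gamma>) \<Longrightarrow> tait \<Gamma>"

definition provable :: "'p fm set \<Rightarrow> 'p fm \<Rightarrow> bool" where
  "provable T A \<longleftrightarrow> (\<exists>\<Gamma>. finite \<Gamma> \<and> \<Gamma> \<subseteq> T \<and> tait (insert A (neg ` \<Gamma>)))"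

definition arith_axioms :: "'p fm set" where
  "arith_axioms =
    {Neq (Succ (Var 0)) Zero,
     Imp (Eq (Succ (Var 0)) (Succ (Var 1))) (Eq (Var 0) (Var 1)),
     Eq (Add (Var 0) Zero) (Var 0),
     Eq (Add (Var 0) (Succ (Var 1))) (Succ (Add (Var 0) (Var 1))),
     Eq (Mul (Var 0) Zero) Zero,
     Eq (Mul (Var 0) (Succ (Var 1))) (Add (Mul (Var 0) (Var 1)) (Var 0)),
     NLess (Var 0) Zero,
     Iff (Less (Var 0) (Succ (Var 1))) (Disj (Less (Var 0) (Var 1)) (Eq (Var 0) (Var 1)))}"

definition induction_axiom :: "'p fm \<Rightarrow> 'p fm" where
  "induction_axiom \<psi> =
    Imp (Conj (inst Zero \<psi>)
              (Forall (Imp \<psi> (subst (case_nat (Succ (Var 0)) (\<lambda>k. Var (Suc k))) \<psi>))))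
        (Forall \<psi>)"


section \<open>Operator forms and the theory of one inductive definition\<close>

primrec pos_in_X :: "'p fm \<Rightarrow> bool" where
  "pos_in_X (Eq s t) = True"
| "pos_in_X (Neq s t) = True"
| "pos_in_X (Less s t) = True"
| "pos_in_X (NLess s t) = True"
| "pos_in_X (Pred p t) = True"
| "pos_in_X (NPred p t) = False"
| "pos_in_X (Conj A B) = (pos_in_X A \<and> pos_in_X B)"
| "pos_in_X (Disj A B) = (pos_in_X A \<and> pos_in_X B)"
| "pos_in_X (Forall A) = pos_in_X A"
| "pos_in_X (Exists A) = pos_in_X A"

typedef opform = "{\<phi> :: unit fm. fv \<phi> \<subseteq> {0} \<and> pos_in_X \<phi>}"
  morphisms form_of Opform
proof
  show "Eq Zero Zero \<in> {\<phi> :: unit fm. fv \<phi> \<subseteq> {0} \<and> pos_in_X \<phi>}" by simp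
qed

text \<open>The language with a predicate symbol \<open>I\<^sub>\<phi>\<close> (namely \<open>Pred \<phi>\<close>) for each operator form \<open>\<phi>\<close>.\<close>

type_synonym id_fm = "opform fm"

text \<open>
  \<open>plug d \<psi> A\<close> replaces each \<open>Xt\<close> in \<open>A\<close> by \<open>\<psi>(t)\<close>, where \<open>A\<close> stands under \<open>d\<close> number
  quantifiers. A parameter \<open>k + 1\<close> of \<open>\<psi>\<close> denotes variable \<open>k + 1\<close> at depth 0, next to the variable
  0 of the operator form, so that \<open>plug 0 \<psi> \<phi>\<close> is \<open>\<phi>(x,\<psi>)\<close> with the parameters of \<open>\<psi>\<close> unchanged.
\<close>

primrec plug :: "nat \<Rightarrow> 'p fm \<Rightarrow> unit fm \<Rightarrow> 'p fm" where
  "plug d \<psi> (Eq s t) = Eq s t"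
| "plug d \<psi> (Neq s t) = Neq s t"
| "plug d \<psi> (Less s t) = Less s t"
| "plug d \<psi> (NLess s t) = NLess s t"
| "plug d \<psi> (Pred p t) = subst (case_nat t (\<lambda>k. Var (Suc k + d))) \<psi>"
| "plug d \<psi> (NPred p t) = neg (subst (case_nat t (\<lambda>k. Var (Suc k + d))) \<psi>)"
| "plug d \<psi> (Conj A B) = Conj (plug d \<psi> A) (plug d \<psi> B)"
| "plug d \<psi> (Disj A B) = Disj (plug d \<psi> A) (plug d \<psi> B)"
| "plug d \<psi> (Forall A) = Forall (plug (Suc d) \<psi> A)"
| "plug d \<psi> (Exists A) = Exists (plug (Suc d) \<psi> A)"

definition op_app :: "opform \<Rightarrow> 'p fm \<Rightarrow> 'p fm" where
  "op_app \<phi> \<psi> = plug 0 \<psi> (form_of \<phi>)"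

definition fixpoint_axiom :: "opform \<Rightarrow> id_fm" where
  "fixpoint_axiom \<phi> = Forall (Imp (op_app \<phi> (Pred \<phi> (Var 0))) (Pred \<phi> (Var 0)))"

definition least_axiom :: "opform \<Rightarrow> id_fm \<Rightarrow> id_fm" where
  "least_axiom \<phi> \<psi> =
    Imp (Forall (Imp (op_app \<phi> \<psi>) \<psi>)) (Forall (Imp (Pred \<phi> (Var 0)) \<psi>))"

definition ID1 :: "id_fm set" where
  "ID1 = univ_closure ` (arith_axioms \<union> range induction_axiom \<union> range fixpoint_axiom
           \<union> {least_axiom \<phi> \<psi> | \<phi> \<psi>. True})"


section \<open>Second order arithmetic\<close>

text \<open>Number variables and set variables are indexed separately.\<close>

datatype fm2 =
    Eq2 tm tm | Neq2 tm tm
  | Less2 tm tm | NLess2 tm tm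
  | Mem tm nat | NMem tm nat
  | Conj2 fm2 fm2 | Disj2 fm2 fm2
  | Forall2 fm2 | Exists2 fm2
  | ForallS fm2 | ExistsS fm2

primrec neg2 :: "fm2 \<Rightarrow> fm2" where
  "neg2 (Eq2 s t) = Neq2 s t"
| "neg2 (Neq2 s t) = Eq2 s t"
| "neg2 (Less2 s t) = NLess2 s t"
| "neg2 (NLess2 s t) = Less2 s t"
| "neg2 (Mem t X) = NMem t X"
| "neg2 (NMem t X) = Mem t X"
| "neg2 (Conj2 A B) = Disj2 (neg2 A) (neg2 B)"
| "neg2 (Disj2 A B) = Conj2 (neg2 A) (neg2 B)"
| "neg2 (Forall2 A) = Exists2 (neg2 A)"
| "neg2 (Exists2 A) = Forall2 (neg2 A)"
| "neg2 (ForallS A) = ExistsS (neg2 A)"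
| "neg2 (ExistsS A) = ForallS (neg2 A)"

definition Imp2 :: "fm2 \<Rightarrow> fm2 \<Rightarrow> fm2" where
  "Imp2 A B = Disj2 (neg2 A) B"

definition Iff2 :: "fm2 \<Rightarrow> fm2 \<Rightarrow> fm2" where
  "Iff2 A B = Conj2 (Imp2 A B) (Imp2 B A)"

primrec fvn2 :: "fm2 \<Rightarrow> nat set" where
  "fvn2 (Eq2 s t) = fv_tm s \<union> fv_tm t"
| "fvn2 (Neq2 s t) = fv_tm s \<union> fv_tm t"
| "fvn2 (Less2 s t) = fv_tm s \<union> fv_tm t"
| "fvn2 (NLess2 s t) = fv_tm s \<union> fv_tm t"
| "fvn2 (Mem t X) = fv_tm t"
| "fvn2 (NMem t X) = fv_tm t"
| "fvn2 (Conj2 A B) = fvn2 A \<union> fvn2 B"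
| "fvn2 (Disj2 A B) = fvn2 A \<union> fvn2 B"
| "fvn2 (Forall2 A) = {n. Suc n \<in> fvn2 A}"
| "fvn2 (Exists2 A) = {n. Suc n \<in> fvn2 A}"
| "fvn2 (ForallS A) = fvn2 A"
| "fvn2 (ExistsS A) = fvn2 A"

primrec fvs2 :: "fm2 \<Rightarrow> nat set" where
  "fvs2 (Eq2 s t) = {}"
| "fvs2 (Neq2 s t) = {}"
| "fvs2 (Less2 s t) = {}"
| "fvs2 (NLess2 s t) = {}"
| "fvs2 (Mem t X) = {X}"
| "fvs2 (NMem t X) = {X}"
| "fvs2 (Conj2 A B) = fvs2 A \<union> fvs2 B"
| "fvs2 (Disj2 A B) = fvs2 A \<union> fvs2 B"
| "fvs2 (Forall2 A) = fvs2 A"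
| "fvs2 (Exists2 A) = fvs2 A"
| "fvs2 (ForallS A) = {X. Suc X \<in> fvs2 A}"
| "fvs2 (ExistsS A) = {X. Suc X \<in> fvs2 A}"

primrec substn2 :: "(nat \<Rightarrow> tm) \<Rightarrow> fm2 \<Rightarrow> fm2" where
  "substn2 \<sigma> (Eq2 s t) = Eq2 (subst_tm \<sigma> s) (subst_tm \<sigma> t)"
| "substn2 \<sigma> (Neq2 s t) = Neq2 (subst_tm \<sigma> s) (subst_tm \<sigma> t)"
| "substn2 \<sigma> (Less2 s t) = Less2 (subst_tm \<sigma> s) (subst_tm \<sigma> t)"
| "substn2 \<sigma> (NLess2 s t) = NLess2 (subst_tm \<sigma> s) (subst_tm \<sigma> t)"
| "substn2 \<sigma> (Mem t X) = Mem (subst_tm \<sigma> t) X"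
| "substn2 \<sigma> (NMem t X) = NMem (subst_tm \<sigma> t) X"
| "substn2 \<sigma> (Conj2 A B) = Conj2 (substn2 \<sigma> A) (substn2 \<sigma> B)"
| "substn2 \<sigma> (Disj2 A B) = Disj2 (substn2 \<sigma> A) (substn2 \<sigma> B)"
| "substn2 \<sigma> (Forall2 A) = Forall2 (substn2 (lift_sub \<sigma>) A)"
| "substn2 \<sigma> (Exists2 A) = Exists2 (substn2 (lift_sub \<sigma>) A)"
| "substn2 \<sigma> (ForallS A) = ForallS (substn2 \<sigma> A)"
| "substn2 \<sigma> (ExistsS A) = ExistsS (substn2 \<sigma> A)"

primrec renS :: "(nat \<Rightarrow> nat) \<Rightarrow> fm2 \<Rightarrow> fm2" where
  "renS \<rho> (Eq2 s t) = Eq2 s t"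
| "renS \<rho> (Neq2 s t) = Neq2 s t"
| "renS \<rho> (Less2 s t) = Less2 s t"
| "renS \<rho> (NLess2 s t) = NLess2 s t"
| "renS \<rho> (Mem t X) = Mem t (\<rho> X)"
| "renS \<rho> (NMem t X) = NMem t (\<rho> X)"
| "renS \<rho> (Conj2 A B) = Conj2 (renS \<rho> A) (renS \<rho> B)"
| "renS \<rho> (Disj2 A B) = Disj2 (renS \<rho> A) (renS \<rho> B)"
| "renS \<rho> (Forall2 A) = Forall2 (renS \<rho> A)"
| "renS \<rho> (Exists2 A) = Exists2 (renS \<rho> A)"
| "renS \<rho> (ForallS A) = ForallS (renS (case_nat 0 (\<lambda>X. Suc (\<rho> X))) A)"
| "renS \<rho> (ExistsS A) = ExistsS (renS (case_nat 0 (\<lambda>X. Suc (\<rho> X))) A)"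

definition shiftn2 :: "fm2 \<Rightarrow> fm2" where
  "shiftn2 = substn2 (\<lambda>i. Var (Suc i))"

definition shiftS :: "fm2 \<Rightarrow> fm2" where
  "shiftS = renS Suc"

definition instn2 :: "tm \<Rightarrow> fm2 \<Rightarrow> fm2" where
  "instn2 t = substn2 (case_nat t Var)"

definition instS :: "nat \<Rightarrow> fm2 \<Rightarrow> fm2" where
  "instS X = renS (case_nat X (\<lambda>Y. Y))"

definition univ_closure2 :: "fm2 \<Rightarrow> fm2" where
  "univ_closure2 A = (ForallS ^^ (LEAST n. \<forall>X\<in>fvs2 A. X < n))
                      ((Forall2 ^^ (LEAST n. \<forall>k\<in>fvn2 A. k < n)) A)"

text \<open>Two-sorted version of the calculus above, with equality for numbers only.\<close>

inductive tait2 :: "fm2 set \<Rightarrow> bool" where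
  Ax2: "A \<in> \<Gamma> \<Longrightarrow> neg2 A \<in> \<Gamma> \<Longrightarrow> tait2 \<Gamma>"
| EqRefl2: "Eq2 t t \<in> \<Gamma> \<Longrightarrow> tait2 \<Gamma>"
| EqSubst2: "Neq2 s t \<in> \<Gamma> \<Longrightarrow> neg2 (instn2 s A) \<in> \<Gamma> \<Longrightarrow> instn2 t A \<in> \<Gamma> \<Longrightarrow> tait2 \<Gamma>"
| ConjR2: "tait2 (insert A \<Gamma>) \<Longrightarrow> tait2 (insert B \<Gamma>) \<Longrightarrow> tait2 (insert (Conj2 A B) \<Gamma>)"
| DisjR2: "tait2 (insert A (insert B \<Gamma>)) \<Longrightarrow> tait2 (insert (Disj2 A B) \<Gamma>)"
| ForallR2: "tait2 (insert A (shiftn2 ` \<Gamma>)) \<Longrightarrow> tait2 (insert (Forall2 A) \<Gamma>)"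
| ExistsR2: "tait2 (insert (instn2 t A) \<Gamma>) \<Longrightarrow> tait2 (insert (Exists2 A) \<Gamma>)"
| ForallSR2: "tait2 (insert A (shiftS ` \<Gamma>)) \<Longrightarrow> tait2 (insert (ForallS A) \<Gamma>)"
| ExistsSR2: "tait2 (insert (instS X A) \<Gamma>) \<Longrightarrow> tait2 (insert (ExistsS A) \<Gamma>)"
| Cut2: "tait2 (insert A \<Gamma>) \<Longrightarrow> tait2 (insert (neg2 A) \<Gamma>) \<Longrightarrow> tait2 \<Gamma>"

text \<open>
  Free set variables of the axioms in \<open>T\<close> act as constants: the eigenvariable condition also
  applies to the axioms used, so nothing can be generalised over them.
\<close>

definition provable2 :: "fm2 set \<Rightarrow> fm2 \<Rightarrow> bool" where
  "provable2 T A \<longleftrightarrow> (\<exists>\<Gamma>. finite \<Gamma> \<and> \<Gamma> \<subseteq> T \<and> tait2 (insert A (neg2 ` \<Gamma>)))"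

text \<open>
  Reading the predicate symbols of a first order formula as set variables; \<open>Y p\<close> is the set variable
  for \<open>p\<close>. First order formulas have no set quantifiers, so the indices need no shifting.
\<close>

primrec to_fm2 :: "('p \<Rightarrow> nat) \<Rightarrow> 'p fm \<Rightarrow> fm2" where
  "to_fm2 Y (Eq s t) = Eq2 s t"
| "to_fm2 Y (Neq s t) = Neq2 s t"
| "to_fm2 Y (Less s t) = Less2 s t"
| "to_fm2 Y (NLess s t) = NLess2 s t"
| "to_fm2 Y (Pred p t) = Mem t (Y p)"
| "to_fm2 Y (NPred p t) = NMem t (Y p)"
| "to_fm2 Y (Conj A B) = Conj2 (to_fm2 Y A) (to_fm2 Y B)"
| "to_fm2 Y (Disj A B) = Disj2 (to_fm2 Y A) (to_fm2 Y B)"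
| "to_fm2 Y (Forall A) = Forall2 (to_fm2 Y A)"
| "to_fm2 Y (Exists A) = Exists2 (to_fm2 Y A)"

primrec arithmetical :: "fm2 \<Rightarrow> bool" where
  "arithmetical (Eq2 s t) = True"
| "arithmetical (Neq2 s t) = True"
| "arithmetical (Less2 s t) = True"
| "arithmetical (NLess2 s t) = True"
| "arithmetical (Mem t X) = True"
| "arithmetical (NMem t X) = True"
| "arithmetical (Conj2 A B) = (arithmetical A \<and> arithmetical B)"
| "arithmetical (Disj2 A B) = (arithmetical A \<and> arithmetical B)"
| "arithmetical (Forall2 A) = arithmetical A"
| "arithmetical (Exists2 A) = arithmetical A"
| "arithmetical (ForallS A) = False"
| "arithmetical (ExistsS A) = False"

definition Pi11 :: "fm2 \<Rightarrow> bool" where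
  "Pi11 A \<longleftrightarrow> (\<exists>B. arithmetical B \<and> A = ForallS B)"

definition set_induction :: fm2 where
  "set_induction =
    Imp2 (Conj2 (Mem Zero 0) (Forall2 (Imp2 (Mem (Var 0) 0) (Mem (Succ (Var 0)) 0))))
         (Forall2 (Mem (Var 0) 0))"

definition comprehension :: "fm2 \<Rightarrow> fm2" where
  "comprehension A = ExistsS (Forall2 (Iff2 (Mem (Var 0) 0) (shiftS A)))"

text \<open>The members of \<open>arith_axioms\<close> contain no predicate symbol, so the map passed to \<open>to_fm2\<close> is irrelevant.\<close>

definition ACA0 :: "fm2 set" where
  "ACA0 = univ_closure2 ` (to_fm2 (\<lambda>_ :: unit. 0) ` arith_axioms \<union> {set_induction}
            \<union> comprehension ` {A. arithmetical A})"

definition Pi11_CA0_minus :: "fm2 set" where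
  "Pi11_CA0_minus =
    ACA0 \<union> univ_closure2 ` comprehension ` {A. Pi11 A \<and> fvs2 A = {}}"

definition Cl :: "opform \<Rightarrow> nat \<Rightarrow> fm2" where
  "Cl \<phi> X = Forall2 (Imp2 (to_fm2 (\<lambda>_. X) (form_of \<phi>)) (Mem (Var 0) X))"

definition LF :: "opform \<Rightarrow> nat \<Rightarrow> fm2" where
  "LF \<phi> Y = Forall2 (Iff2 (Mem (Var 0) Y) (ForallS (Imp2 (Cl \<phi> 0) (Mem (Var 0) 0))))"

abbreviation star :: "(opform \<Rightarrow> nat) \<Rightarrow> id_fm \<Rightarrow> fm2" where
  "star Y \<psi> \<equiv> to_fm2 Y \<psi>"

instance tm :: countable by countable_datatype
instance fm :: (countable) countable by countable_datatype

text \<open>An assignment of pairwise distinct set variables \<open>Y\<^sub>\<phi>\<close> to the operator forms exists.\<close>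

lemma ex_inj_opform: "\<exists>Y :: opform \<Rightarrow> nat. inj Y"
proof
  show "inj (\<lambda>\<phi>. to_nat (form_of \<phi>))"
    by (rule injI) (simp add: form_of_inject)
qed

end

theory Submission
  imports Defs "HOL-Library.Countable_Set"
begin

text \<open>
  The proof is semantic. If \<open>ID1\<close> does not prove \<open>\<psi>\<close>, completeness yields a countable model of
  \<open>ID1\<close> refuting \<open>\<psi>\<close>. Expand it to a second order structure by the sets definable with parameters
  in the language of \<open>ID1\<close>, reading \<open>Y\<^sub>\<phi>\<close> as the extension of \<open>I\<^sub>\<phi>\<close>. Arithmetical comprehension and
  set induction are then clear, and the axioms (F) and (L) say exactly that \<open>LF\<close> holds.

  For parameter-free \<open>\<Pi>\<^sup>1\<^sub>1\<close> comprehension it suffices to define the set of \<open>e\<close> such that some definable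
  \<open>X\<close> satisfies a given arithmetical \<open>B(e,X)\<close>. Such an \<open>X\<close> amounts to a definable Hintikka set
  containing \<open>B(e,X)\<close>. Call a finite list of instances of subformulas of \<open>B\<close> refutable if it closes
  under the rules of a cut-free calculus with \<open>\<omega>\<close>-rule; this is a positive inductive definition. A
  Hintikka set containing a list witnesses that it is not refutable, and conversely an irrefutable list
  is extended to a Hintikka set by a fair, definable recursion that stays irrefutable at each stage.
\<close>

text \<open>The obstacle is that an operator form may mention neither another \<open>I\<close> nor
  parameters, so the rules of the refutation calculus have to be arithmetical. This is where the
  absence of set parameters enters: the only membership literals of \<open>B\<close> concern the
  quantified set, and they conflict by comparing values of terms, whereas literals about a parameter
  set would have to be decided inside the operator form. Number parameters are harmless, because
  they move into the environment code that each obligation carries. The model may be nonstandard.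
  Lists, stages and the premises of the infinitary rule are indexed by its elements, so every
  induction along them must be an instance of an axiom of \<open>ID1\<close> for a definable
  predicate. Only \<open>B\<close> stays outside: it has finitely many subformulas, so case
  distinctions on them are finite disjunctions, and satisfaction is defined by recursion in the
  metatheory. The fair recursion picks the least code of an irrefutable extension; induction for
  formulas containing \<open>I\<close> supplies that least code, the recursion itself, and
  irrefutability at nonstandard stages.\<close>

instance opform :: countable
proof
  have "inj (\<lambda>\<phi>. to_nat (form_of \<phi>))"
    by (rule injI) (simp add: form_of_inject)
  then show "\<exists>f :: opform \<Rightarrow> nat. inj f" by blast
qed

text \<open>Supplies the formula tags in the coded obligations \<open>ob\<close>.\<close>

instance fm2 :: countable by countable_datatype

section \<open>Substitution\<close>

lemma subst_tm_comp: "subst_tm \<tau> (subst_tm \<sigma> t) = subst_tm (\<lambda>i. subst_tm \<tau> (\<sigma> i)) t"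
  by (induction t) auto

lemma lift_sub_comp:
  "(\<lambda>i. subst_tm (lift_sub \<tau>) (lift_sub \<sigma> i)) = lift_sub (\<lambda>i. subst_tm \<tau> (\<sigma> i))"
  by (rule ext) (simp add: lift_sub_def subst_tm_comp split: nat.split)

lemma subst_comp: "subst \<tau> (subst \<sigma> A) = subst (\<lambda>i. subst_tm \<tau> (\<sigma> i)) A"
  by (induction A arbitrary: \<sigma> \<tau>) (auto simp: subst_tm_comp lift_sub_comp)

lemma subst_tm_cong: "(\<And>i. i \<in> fv_tm t \<Longrightarrow> \<sigma> i = \<tau> i) \<Longrightarrow> subst_tm \<sigma> t = subst_tm \<tau> t"
  by (induction t) auto

lemma subst_cong: "(\<And>i. i \<in> fv A \<Longrightarrow> \<sigma> i = \<tau> i) \<Longrightarrow> subst \<sigma> A = subst \<tau> A"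
proof (induction A arbitrary: \<sigma> \<tau>)
  case (Forall A)
  have "subst (lift_sub \<sigma>) A = subst (lift_sub \<tau>) A"
    by (rule Forall.IH) (use Forall.prems in \<open>auto simp: lift_sub_def split: nat.split\<close>)
  then show ?case by simp
next
  case (Exists A)
  have "subst (lift_sub \<sigma>) A = subst (lift_sub \<tau>) A"
    by (rule Exists.IH) (use Exists.prems in \<open>auto simp: lift_sub_def split: nat.split\<close>)
  then show ?case by simp
next
  case (Conj A B)
  have "subst \<sigma> A = subst \<tau> A" "subst \<sigma> B = subst \<tau> B"
    by (rule Conj.IH; use Conj.prems in simp)+
  then show ?case by simp
next
  case (Disj A B)
  have "subst \<sigma> A = subst \<tau> A" "subst \<sigma> B = subst \<tau> B"
    by (rule Disj.IH; use Disj.prems in simp)+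
  then show ?case by simp
qed (auto intro!: subst_tm_cong)

lemma subst_tm_Var [simp]: "subst_tm Var t = t"
  by (induction t) auto

lemma lift_sub_Var [simp]: "lift_sub Var = Var"
  by (rule ext) (simp add: lift_sub_def split: nat.split)

lemma subst_Var [simp]: "subst Var A = A"
  by (induction A) auto

lemma subst_sentence: "fv A = {} \<Longrightarrow> subst \<sigma> A = A"
  using subst_cong[of A \<sigma> Var] by simp

lemma neg_neg [simp]: "neg (neg A) = A"
  by (induction A) auto

lemma fv_neg [simp]: "fv (neg A) = fv A"
  by (induction A) auto

lemma subst_neg: "subst \<sigma> (neg A) = neg (subst \<sigma> A)"
  by (induction A arbitrary: \<sigma>) auto

lemma inst_subst_lift: "inst t (subst (lift_sub \<sigma>) A) = subst (case_nat t \<sigma>) A"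
  unfolding inst_def subst_comp
  by (rule arg_cong[of _ _ "\<lambda>\<sigma>. subst \<sigma> A"], rule ext)
    (simp add: lift_sub_def subst_tm_comp split: nat.split)

lemma subst_inst: "subst \<sigma> (inst t A) = inst (subst_tm \<sigma> t) (subst (lift_sub \<sigma>) A)"
  unfolding inst_subst_lift unfolding inst_def subst_comp
  by (rule arg_cong[of _ _ "\<lambda>\<sigma>. subst \<sigma> A"], rule ext) (simp split: nat.split)

lemma subst_shift: "subst (lift_sub \<sigma>) (shift A) = shift (subst \<sigma> A)"
  unfolding shift_def subst_comp
  by (rule arg_cong[of _ _ "\<lambda>\<sigma>. subst \<sigma> A"], rule ext) (simp add: lift_sub_def)

lemma finite_fv_tm [simp]: "finite (fv_tm t)"
  by (induction t) auto

lemma finite_Suc_preimage: "finite N \<Longrightarrow> finite {n. Suc n \<in> N}"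
  using finite_vimageI[of N Suc] by (simp add: vimage_def)

lemma finite_fv [simp]: "finite (fv A)"
  by (induction A) (auto intro: finite_Suc_preimage)

lemma fv_Forall_funpow: "fv ((Forall ^^ n) A) = {k. k + n \<in> fv A}"
  by (induction n) auto

lemma fv_univ_closure: "fv (univ_closure A) = {}"
proof -
  have "\<exists>n. \<forall>k\<in>fv A. k < n"
    using finite_nat_set_iff_bounded[of "fv A"] by simp
  then have "\<forall>k\<in>fv A. k < (LEAST n. \<forall>k\<in>fv A. k < n)"
    by (rule LeastI_ex)
  then show ?thesis
    by (fastforce simp: univ_closure_def fv_Forall_funpow)
qed

section \<open>Completeness\<close>

text \<open>Weakening is admissible because every rule carries an arbitrary context; the principal
  formula already lies in \<open>\<Delta>\<close> and is absorbed.\<close>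

lemma tait_mono: "tait \<Gamma> \<Longrightarrow> \<Gamma> \<subseteq> \<Delta> \<Longrightarrow> tait \<Delta>"
proof (induction arbitrary: \<Delta> rule: tait.induct)
  case (ConjR A \<Gamma> B)
  have "tait (insert (Conj A B) \<Delta>)"
    by (rule tait.ConjR; rule ConjR.IH) (use ConjR.prems in auto)
  then show ?case using ConjR.prems by (simp add: insert_absorb)
next
  case (DisjR A B \<Gamma>)
  have "tait (insert (Disj A B) \<Delta>)"
    by (rule tait.DisjR, rule DisjR.IH) (use DisjR.prems in auto)
  then show ?case using DisjR.prems by (simp add: insert_absorb)
next
  case (ForallR A \<Gamma>)
  have "tait (insert (Forall A) \<Delta>)"
    by (rule tait.ForallR, rule ForallR.IH) (use ForallR.prems in auto)
  then show ?case using ForallR.prems by (simp add: insert_absorb)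
next
  case (ExistsR t A \<Gamma>)
  have "tait (insert (Exists A) \<Delta>)"
    by (rule tait.ExistsR[of t], rule ExistsR.IH) (use ExistsR.prems in auto)
  then show ?case using ExistsR.prems by (simp add: insert_absorb)
next
  case (Cut A \<Gamma>)
  show ?case
    by (rule tait.Cut[of A]; rule Cut.IH) (use Cut.prems in auto)
qed (blast intro: tait.Ax tait.EqRefl tait.EqSubst)+

lemma tait_subst: "tait \<Gamma> \<Longrightarrow> tait (subst \<sigma> ` \<Gamma>)"
proof (induction arbitrary: \<sigma> rule: tait.induct)
  case (Ax A \<Gamma>)
  then show ?case
    by (intro tait.Ax[of "subst \<sigma> A"]) (auto simp: subst_neg[symmetric])
next
  case (EqRefl t \<Gamma>)
  have "subst \<sigma> (Eq t t) \<in> subst \<sigma> ` \<Gamma>" using EqRefl by blast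
  then show ?case by (auto intro: tait.EqRefl)
next
  case (EqSubst s t \<Gamma> A)
  have "subst \<sigma> (Neq s t) \<in> subst \<sigma> ` \<Gamma>" "subst \<sigma> (neg (inst s A)) \<in> subst \<sigma> ` \<Gamma>"
    "subst \<sigma> (inst t A) \<in> subst \<sigma> ` \<Gamma>"
    using EqSubst by blast+
  then show ?case
    by (intro tait.EqSubst[of "subst_tm \<sigma> s" "subst_tm \<sigma> t" _ "subst (lift_sub \<sigma>) A"])
      (simp_all add: subst_neg subst_inst)
next
  case (ConjR A \<Gamma> B)
  then show ?case by (auto intro!: tait.ConjR)
next
  case (DisjR A B \<Gamma>)
  from DisjR.IH[of \<sigma>] show ?case by (auto intro!: tait.DisjR)
next
  case (ForallR A \<Gamma>)
  have "subst (lift_sub \<sigma>) ` shift ` \<Gamma> = shift ` subst \<sigma> ` \<Gamma>"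
    by (simp add: image_image subst_shift)
  with ForallR.IH[of "lift_sub \<sigma>"] show ?case by (auto intro!: tait.ForallR)
next
  case (ExistsR t A \<Gamma>)
  from ExistsR.IH[of \<sigma>] show ?case
    by (auto intro!: tait.ExistsR[of "subst_tm \<sigma> t"] simp: subst_inst)
next
  case (Cut A \<Gamma>)
  from Cut.IH[of \<sigma>] show ?case
    by - (rule tait.Cut[of "subst \<sigma> A"], simp_all add: subst_neg)
qed

text \<open>\<open>ForallR\<close> insists on index 0 as eigenvariable. One simultaneous
  substitution, sending \<open>y\<close> to 0 and raising all other variables, brings a derivation
  with any fresh \<open>y\<close> into that shape.\<close>

lemma tait_Forall_fresh:
  assumes "tait (insert (inst (Var y) A) \<Gamma>)"
    and "y \<notin> fv (Forall A)" and "\<And>B. B \<in> \<Gamma> \<Longrightarrow> y \<notin> fv B"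
  shows "tait (insert (Forall A) \<Gamma>)"
proof -
  define \<sigma> where "\<sigma> = (\<lambda>i. Var (Suc i))(y := Var 0)"
  have "subst \<sigma> (inst (Var y) A) = subst Var A"
    unfolding inst_def subst_comp using assms(2)
    by (intro subst_cong) (auto simp: \<sigma>_def split: nat.split)
  moreover have "subst \<sigma> ` \<Gamma> = shift ` \<Gamma>"
    using assms(3) by (intro image_cong) (auto simp: \<sigma>_def shift_def intro!: subst_cong)
  ultimately show ?thesis
    using tait_subst[OF assms(1), of \<sigma>] by (auto intro: tait.ForallR)
qed

text \<open>Of \<open>T\<close> a finite part is selected, while \<open>S\<close> enters whole.
  Keeping the two apart lets the Henkin construction carry only a finite \<open>S\<close>, which
  always leaves variables fresh.\<close>

definition inconsistent :: "'p fm set \<Rightarrow> 'p fm set \<Rightarrow> bool" where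
  "inconsistent T S \<longleftrightarrow> (\<exists>\<Gamma>. finite \<Gamma> \<and> \<Gamma> \<subseteq> T \<and> tait (neg ` \<Gamma> \<union> neg ` S))"

lemma inconsistent_neg: "inconsistent T {neg A} \<longleftrightarrow> provable T A"
  by (simp add: inconsistent_def provable_def)

lemma inconsistent_mono: "inconsistent T S \<Longrightarrow> S \<subseteq> S' \<Longrightarrow> inconsistent T S'"
  unfolding inconsistent_def
  by (elim exE conjE, rule_tac x = \<Gamma> in exI, simp) (erule tait_mono, blast)

lemma inconsistent_cut:
  assumes "inconsistent T (insert A S)" and "inconsistent T (insert (neg A) S)"
  shows "inconsistent T S"
proof -
  obtain \<Gamma> \<Delta> where \<Gamma>: "finite \<Gamma>" "\<Gamma> \<subseteq> T" "tait (neg ` \<Gamma> \<union> neg ` insert A S)"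
    and \<Delta>: "finite \<Delta>" "\<Delta> \<subseteq> T" "tait (neg ` \<Delta> \<union> neg ` insert (neg A) S)"
    using assms by (auto simp: inconsistent_def)
  have "tait (insert (neg A) (neg ` (\<Gamma> \<union> \<Delta>) \<union> neg ` S))"
    by (rule tait_mono[OF \<Gamma>(3)]) auto
  moreover have "tait (insert A (neg ` (\<Gamma> \<union> \<Delta>) \<union> neg ` S))"
    by (rule tait_mono[OF \<Delta>(3)]) auto
  ultimately have "tait (neg ` (\<Gamma> \<union> \<Delta>) \<union> neg ` S)"
    by (rule tait.Cut[rotated])
  then show ?thesis using \<Gamma> \<Delta> unfolding inconsistent_def
    by (intro exI[of _ "\<Gamma> \<union> \<Delta>"]) auto
qed

text \<open>Members of \<open>T\<close> are sentences, so freshness for \<open>S\<close> is enough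
  to generalise over \<open>y\<close>. The outcome is the negation of the existential formula in
  \<open>S\<close> and is absorbed.\<close>

lemma inconsistent_witness:
  assumes "inconsistent T (insert (inst (Var y) A) S)" and "Exists A \<in> S"
    and "\<And>B. B \<in> S \<Longrightarrow> y \<notin> fv B" and "\<And>B. B \<in> T \<Longrightarrow> fv B = {}"
  shows "inconsistent T S"
proof -
  obtain \<Gamma> where \<Gamma>: "finite \<Gamma>" "\<Gamma> \<subseteq> T" "tait (neg ` \<Gamma> \<union> neg ` insert (inst (Var y) A) S)"
    using assms(1) by (auto simp: inconsistent_def)
  have "tait (insert (inst (Var y) (neg A)) (neg ` \<Gamma> \<union> neg ` S))"
    using \<Gamma>(3) by (simp add: inst_def subst_neg)
  then have "tait (insert (Forall (neg A)) (neg ` \<Gamma> \<union> neg ` S))"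
  proof (rule tait_Forall_fresh)
    show "y \<notin> fv (Forall (neg A))" using assms(2,3) by fastforce
    show "y \<notin> fv B" if "B \<in> neg ` \<Gamma> \<union> neg ` S" for B
      using that \<Gamma>(2) assms(3,4) by auto
  qed
  moreover have "Forall (neg A) \<in> neg ` S"
    using assms(2) by (force intro: image_eqI[of _ _ "Exists A"])
  ultimately show ?thesis using \<Gamma> unfolding inconsistent_def
    by (intro exI[of _ \<Gamma>]) (simp add: insert_absorb)
qed

locale henkin_set =
  fixes T H :: "'p fm set"
  assumes consistent: "finite F \<Longrightarrow> F \<subseteq> H \<Longrightarrow> \<not> inconsistent T F"
    and complete: "A \<in> H \<or> neg A \<in> H"
    and witness: "Exists A \<in> H \<Longrightarrow> \<exists>t. inst t A \<in> H"

text \<open>Free variables act as Henkin constants, so the language is never extended.\<close>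

fun henkin_witness :: "'p fm set \<Rightarrow> 'p fm \<Rightarrow> 'p fm set" where
  "henkin_witness S (Exists A) = {inst (Var (SOME y. \<forall>B\<in>insert (Exists A) S. y \<notin> fv B)) A}"
| "henkin_witness S _ = {}"

primrec henkin_chain :: "'p::countable fm set \<Rightarrow> 'p fm \<Rightarrow> nat \<Rightarrow> 'p fm set" where
  "henkin_chain T A 0 = {A}"
| "henkin_chain T A (Suc n) =
    (let S = henkin_chain T A n in
     if inconsistent T (insert (from_nat n) S) then S
     else insert (from_nat n) S \<union> henkin_witness S (from_nat n))"

lemma finite_henkin_witness: "finite (henkin_witness S A)"
  by (cases A) auto

lemma finite_henkin_chain: "finite (henkin_chain T A n)"
  by (induction n) (auto simp: Let_def finite_henkin_witness)

lemma henkin_chain_mono: "m \<le> n \<Longrightarrow> henkin_chain T A m \<subseteq> henkin_chain T A n"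
  by (rule lift_Suc_mono_le[of "henkin_chain T A"]) (auto simp: Let_def)

lemma henkin_witness_consistent:
  assumes "finite S" and "\<not> inconsistent T (insert A S)" and "\<And>B. B \<in> T \<Longrightarrow> fv B = {}"
  shows "\<not> inconsistent T (insert A S \<union> henkin_witness S A)"
proof (cases A)
  case (Exists B)
  define y where "y = (SOME y. \<forall>C\<in>insert A S. y \<notin> fv C)"
  have "finite (\<Union> (fv ` insert A S))" using assms(1) by auto
  then have "\<exists>y. y \<notin> \<Union> (fv ` insert A S)"
    by (rule ex_new_if_finite[OF infinite_UNIV_nat])
  then have "\<exists>y. \<forall>C\<in>insert A S. y \<notin> fv C" by blast
  then have "\<forall>C\<in>insert A S. y \<notin> fv C"
    unfolding y_def by (rule someI_ex)
  then have y: "C \<in> insert A S \<Longrightarrow> y \<notin> fv C" for C by blast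
  have "insert A S \<union> henkin_witness S A = insert (inst (Var y) B) (insert A S)"
    unfolding y_def Exists by (simp only: henkin_witness.simps) blast
  moreover have "Exists B \<in> insert A S" using Exists by simp
  ultimately show ?thesis
    using inconsistent_witness[of T y B "insert A S"] assms(2,3) y by metis
qed (use assms in simp_all)

lemma henkin_chain_consistent:
  assumes "\<not> inconsistent T {A}" and "\<And>B. B \<in> T \<Longrightarrow> fv B = {}"
  shows "\<not> inconsistent T (henkin_chain T A n)"
proof (induction n)
  case (Suc n)
  then show ?case
    using henkin_witness_consistent[OF finite_henkin_chain[of T A n] _ assms(2), where A = "from_nat n"]
    by (simp only: henkin_chain.simps Let_def split: if_split) blast
qed (use assms in simp)

lemma henkin_set_exists:
  fixes T :: "'p::countable fm set"
  assumes "\<not> inconsistent T {A}" and T: "\<And>B. B \<in> T \<Longrightarrow> fv B = {}"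
  shows "\<exists>H. henkin_set T H \<and> A \<in> H"
proof -
  define C where "C = henkin_chain T A"
  have mono: "m \<le> n \<Longrightarrow> C m \<subseteq> C n" for m n
    unfolding C_def by (rule henkin_chain_mono)
  have con: "\<not> inconsistent T (C n)" for n
    unfolding C_def using assms by (rule henkin_chain_consistent)
  have fin: "\<exists>n. F \<subseteq> C n" if "finite F" "F \<subseteq> \<Union> (range C)" for F
    using that
  proof (induction F)
    case (insert B F)
    then obtain m n where "F \<subseteq> C m" "B \<in> C n" by auto
    then have "insert B F \<subseteq> C (max m n)"
      using mono[of m "max m n"] mono[of n "max m n"] by auto
    then show ?case by blast
  qed simp
  have H1: "\<not> inconsistent T F" if "finite F" "F \<subseteq> \<Union> (range C)" for F
    using fin[OF that] con inconsistent_mono[of T F] by auto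
  have in_or: "B \<in> C (Suc (to_nat B)) \<or> inconsistent T (insert B (C (to_nat B)))" for B
    by (auto simp: C_def Let_def)
  \<comment> \<open>If both were missing, each was rejected at its own stage; at the later stage
    both additions are inconsistent, and cut refutes that stage itself.\<close>
  have H2: "B \<in> \<Union> (range C) \<or> neg B \<in> \<Union> (range C)" for B
  proof (rule ccontr)
    assume *: "\<not> ?thesis"
    define n where "n = max (to_nat B) (to_nat (neg B))"
    have "inconsistent T (insert B (C n))"
      using * in_or[of B] mono[of "to_nat B" n]
      by - (rule inconsistent_mono[of T "insert B (C (to_nat B))"], auto simp: n_def)
    moreover have "inconsistent T (insert (neg B) (C n))"
      using * in_or[of "neg B"] mono[of "to_nat (neg B)" n]
      by - (rule inconsistent_mono[of T "insert (neg B) (C (to_nat (neg B)))"], auto simp: n_def)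
    ultimately show False using inconsistent_cut[of T B "C n"] con[of n] by simp
  qed
  \<comment> \<open>An existential formula that ever enters is consistent with the stage carrying
    its own number, so it was accepted there together with its witness.\<close>
  have H3: "\<exists>t. inst t B \<in> \<Union> (range C)" if ex: "Exists B \<in> \<Union> (range C)" for B
  proof -
    let ?n = "to_nat (Exists B)"
    obtain m where "Exists B \<in> C m" using ex by auto
    then have "insert (Exists B) (C ?n) \<subseteq> C (max m ?n)"
      using mono[of m "max m ?n"] mono[of ?n "max m ?n"] by auto
    then have "\<not> inconsistent T (insert (Exists B) (C ?n))"
      using con inconsistent_mono[of T _ "C (max m ?n)"] by auto
    then have "henkin_witness (C ?n) (Exists B) \<subseteq> C (Suc ?n)"
      by (auto simp: C_def Let_def)
    then show ?thesis by auto
  qed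
  have "henkin_set T (\<Union> (range C))"
    by unfold_locales (use H1 H2 H3 in auto)
  moreover have "A \<in> \<Union> (range C)"
    by (auto simp: C_def intro: exI[of _ 0])
  ultimately show ?thesis by blast
qed

section \<open>Structures\<close>

record 'a arith =
  zer :: 'a
  sc :: "'a \<Rightarrow> 'a"
  ad :: "'a \<Rightarrow> 'a \<Rightarrow> 'a"
  mu :: "'a \<Rightarrow> 'a \<Rightarrow> 'a"
  ls :: "'a \<Rightarrow> 'a \<Rightarrow> bool"

primrec eval :: "'a arith \<Rightarrow> (nat \<Rightarrow> 'a) \<Rightarrow> tm \<Rightarrow> 'a" where
  "eval M e (Var n) = e n"
| "eval M e Zero = zer M"
| "eval M e (Succ t) = sc M (eval M e t)"
| "eval M e (Add s t) = ad M (eval M e s) (eval M e t)"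
| "eval M e (Mul s t) = mu M (eval M e s) (eval M e t)"

primrec sat :: "'a arith \<Rightarrow> ('p \<Rightarrow> 'a \<Rightarrow> bool) \<Rightarrow> (nat \<Rightarrow> 'a) \<Rightarrow> 'p fm \<Rightarrow> bool" where
  "sat M P e (Eq s t) \<longleftrightarrow> eval M e s = eval M e t"
| "sat M P e (Neq s t) \<longleftrightarrow> eval M e s \<noteq> eval M e t"
| "sat M P e (Less s t) \<longleftrightarrow> ls M (eval M e s) (eval M e t)"
| "sat M P e (NLess s t) \<longleftrightarrow> \<not> ls M (eval M e s) (eval M e t)"
| "sat M P e (Pred p t) \<longleftrightarrow> P p (eval M e t)"
| "sat M P e (NPred p t) \<longleftrightarrow> \<not> P p (eval M e t)"
| "sat M P e (Conj A B) \<longleftrightarrow> sat M P e A \<and> sat M P e B"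
| "sat M P e (Disj A B) \<longleftrightarrow> sat M P e A \<or> sat M P e B"
| "sat M P e (Forall A) \<longleftrightarrow> (\<forall>x. sat M P (case_nat x e) A)"
| "sat M P e (Exists A) \<longleftrightarrow> (\<exists>x. sat M P (case_nat x e) A)"

lemma eval_subst_tm: "eval M e (subst_tm \<sigma> t) = eval M (\<lambda>i. eval M e (\<sigma> i)) t"
  by (induction t) auto

lemma eval_lift_sub:
  "(\<lambda>i. eval M (case_nat x e) (lift_sub \<sigma> i)) = case_nat x (\<lambda>i. eval M e (\<sigma> i))"
  by (rule ext) (simp add: lift_sub_def eval_subst_tm split: nat.split)

lemma sat_subst: "sat M P e (subst \<sigma> A) \<longleftrightarrow> sat M P (\<lambda>i. eval M e (\<sigma> i)) A"
  by (induction A arbitrary: e \<sigma>) (auto simp: eval_subst_tm eval_lift_sub)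

lemma sat_neg [simp]: "sat M P e (neg A) \<longleftrightarrow> \<not> sat M P e A"
  by (induction A arbitrary: e) auto

lemma sat_Imp [simp]: "sat M P e (Imp A B) \<longleftrightarrow> (sat M P e A \<longrightarrow> sat M P e B)"
  by (simp add: Imp_def)

lemma sat_Iff [simp]: "sat M P e (Iff A B) \<longleftrightarrow> (sat M P e A \<longleftrightarrow> sat M P e B)"
  by (auto simp: Iff_def)

section \<open>The term model of a Henkin set\<close>

context henkin_set
begin

lemma tait_False:
  assumes "tait (neg ` F)" and "finite F" and "F \<subseteq> H"
  shows False
proof -
  have "inconsistent T F"
    unfolding inconsistent_def by (intro exI[of _ "{}"]) (simp add: assms(1))
  then show False using consistent assms(2,3) by blast
qed

lemma neg_iff: "neg A \<in> H \<longleftrightarrow> A \<notin> H"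
proof -
  have False if "A \<in> H" "neg A \<in> H"
    by (rule tait_False[of "{A, neg A}"]) (use that in \<open>auto intro: tait.Ax\<close>)
  then show ?thesis using complete by blast
qed

lemma axioms: "T \<subseteq> H"
proof
  fix A assume "A \<in> T"
  then have "inconsistent T {neg A}"
    unfolding inconsistent_def by (intro exI[of _ "{A}"]) (auto intro: tait.Ax[of A])
  then show "A \<in> H" using consistent[of "{neg A}"] neg_iff by auto
qed

lemma Conj_iff: "Conj A B \<in> H \<longleftrightarrow> A \<in> H \<and> B \<in> H"
proof
  assume AB: "Conj A B \<in> H"
  have "tait {Disj (neg A) (neg B), A}" "tait {Disj (neg A) (neg B), B}"
    by (rule tait.DisjR, blast intro: tait.Ax)+
  then have False if "neg A \<in> H \<or> neg B \<in> H"
    using that AB tait_False[of "{Conj A B, neg A}"] tait_False[of "{Conj A B, neg B}"] by auto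
  then show "A \<in> H \<and> B \<in> H" by (auto simp: neg_iff)
next
  assume AB: "A \<in> H \<and> B \<in> H"
  have "tait (insert (Conj A B) {neg A, neg B})"
    by (rule tait.ConjR) (blast intro: tait.Ax)+
  then show "Conj A B \<in> H"
    using AB tait_False[of "{Disj (neg A) (neg B), A, B}"] neg_iff[of "Conj A B"] by auto
qed

lemma Disj_iff: "Disj A B \<in> H \<longleftrightarrow> A \<in> H \<or> B \<in> H"
  using Conj_iff[of "neg A" "neg B"] neg_iff[of "Disj A B"] by (auto simp: neg_iff)

lemma Forall_iff: "Forall A \<in> H \<longleftrightarrow> (\<forall>t. inst t A \<in> H)"
proof
  assume A: "Forall A \<in> H"
  show "\<forall>t. inst t A \<in> H"
  proof
    fix t
    have "tait (insert (Exists (neg A)) {inst t A})"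
      by (rule tait.ExistsR[of t], rule tait.Ax[of "inst t A"]) (auto simp: inst_def subst_neg)
    then show "inst t A \<in> H"
      using A tait_False[of "{Forall A, neg (inst t A)}"] neg_iff[of "inst t A"] by auto
  qed
next
  assume "\<forall>t. inst t A \<in> H"
  then show "Forall A \<in> H"
    using witness[of "neg A"] neg_iff[of "Forall A"] by (auto simp: inst_def subst_neg neg_iff)
qed

lemma Exists_iff: "Exists A \<in> H \<longleftrightarrow> (\<exists>t. inst t A \<in> H)"
  using Forall_iff[of "neg A"] neg_iff[of "Exists A"] by (auto simp: inst_def subst_neg neg_iff)

lemma Eq_refl: "Eq t t \<in> H"
  using tait_False[of "{Neq t t}"] neg_iff[of "Eq t t"] by (auto intro: tait.EqRefl)

lemma Eq_subst:
  assumes "Eq s t \<in> H" and "inst s A \<in> H"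
  shows "inst t A \<in> H"
proof -
  have "tait {Neq s t, neg (inst s A), inst t A}"
    by (rule tait.EqSubst[of s t _ A]) auto
  then show ?thesis
    using assms tait_False[of "{Eq s t, inst s A, neg (inst t A)}"] neg_iff[of "inst t A"] by auto
qed

text \<open>In the Leibniz contexts below, variable 0 marks the place to be rewritten; the other
  terms are shifted so that the instantiation leaves them alone.\<close>

lemma subst_tm_shift_case_nat: "subst_tm (case_nat s Var) (subst_tm (\<lambda>i. Var (Suc i)) t) = t"
  by (simp add: subst_tm_comp)

lemma Eq_sym: "Eq s t \<in> H \<Longrightarrow> Eq t s \<in> H"
  using Eq_subst[of s t "Eq (Var 0) (subst_tm (\<lambda>i. Var (Suc i)) s)"] Eq_refl[of s]
  by (simp add: inst_def subst_tm_shift_case_nat)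

lemma Eq_trans: "Eq r s \<in> H \<Longrightarrow> Eq s t \<in> H \<Longrightarrow> Eq r t \<in> H"
  using Eq_subst[of s t "Eq (subst_tm (\<lambda>i. Var (Suc i)) r) (Var 0)"]
  by (simp add: inst_def subst_tm_shift_case_nat)

lemma Eq_Succ: "Eq s t \<in> H \<Longrightarrow> Eq (Succ s) (Succ t) \<in> H"
  using Eq_subst[of s t "Eq (subst_tm (\<lambda>i. Var (Suc i)) (Succ s)) (Succ (Var 0))"]
    Eq_refl[of "Succ s"]
  by (simp add: inst_def subst_tm_shift_case_nat)

lemma Eq_Add:
  assumes "Eq s s' \<in> H" and "Eq t t' \<in> H"
  shows "Eq (Add s t) (Add s' t') \<in> H"
proof (rule Eq_trans)
  show "Eq (Add s t) (Add s' t) \<in> H"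
    using Eq_subst[OF assms(1), of "Eq (subst_tm (\<lambda>i. Var (Suc i)) (Add s t))
      (Add (Var 0) (subst_tm (\<lambda>i. Var (Suc i)) t))"] Eq_refl[of "Add s t"]
    by (simp add: inst_def subst_tm_shift_case_nat)
  show "Eq (Add s' t) (Add s' t') \<in> H"
    using Eq_subst[OF assms(2), of "Eq (subst_tm (\<lambda>i. Var (Suc i)) (Add s' t))
      (Add (subst_tm (\<lambda>i. Var (Suc i)) s') (Var 0))"] Eq_refl[of "Add s' t"]
    by (simp add: inst_def subst_tm_shift_case_nat)
qed

lemma Eq_Mul:
  assumes "Eq s s' \<in> H" and "Eq t t' \<in> H"
  shows "Eq (Mul s t) (Mul s' t') \<in> H"
proof (rule Eq_trans)
  show "Eq (Mul s t) (Mul s' t) \<in> H"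
    using Eq_subst[OF assms(1), of "Eq (subst_tm (\<lambda>i. Var (Suc i)) (Mul s t))
      (Mul (Var 0) (subst_tm (\<lambda>i. Var (Suc i)) t))"] Eq_refl[of "Mul s t"]
    by (simp add: inst_def subst_tm_shift_case_nat)
  show "Eq (Mul s' t) (Mul s' t') \<in> H"
    using Eq_subst[OF assms(2), of "Eq (subst_tm (\<lambda>i. Var (Suc i)) (Mul s' t))
      (Mul (subst_tm (\<lambda>i. Var (Suc i)) s') (Var 0))"] Eq_refl[of "Mul s' t"]
    by (simp add: inst_def subst_tm_shift_case_nat)
qed

lemma Less_cong:
  assumes "Eq s s' \<in> H" and "Eq t t' \<in> H" and "Less s t \<in> H"
  shows "Less s' t' \<in> H"
proof -
  have "Less s' t \<in> H"
    using Eq_subst[OF assms(1), of "Less (Var 0) (subst_tm (\<lambda>i. Var (Suc i)) t)"] assms(3)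
    by (simp add: inst_def subst_tm_shift_case_nat)
  then show ?thesis
    using Eq_subst[OF assms(2), of "Less (subst_tm (\<lambda>i. Var (Suc i)) s') (Var 0)"]
    by (simp add: inst_def subst_tm_shift_case_nat)
qed

lemma Pred_cong: "Eq s t \<in> H \<Longrightarrow> Pred p s \<in> H \<Longrightarrow> Pred p t \<in> H"
  using Eq_subst[of s t "Pred p (Var 0)"] by (simp add: inst_def)

text \<open>The hypothesis ranges over all substitutions because opening a quantifier changes the
  substitution: \<open>\<tau>\<close> is recovered from its tail and the instance
  \<open>\<tau> 0\<close>.\<close>

lemma subst_Forall_funpow_mem:
  "(\<And>\<sigma>. subst \<sigma> ((Forall ^^ n) A) \<in> H) \<Longrightarrow> subst \<sigma> A \<in> H"
proof (induction n arbitrary: \<sigma>)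
  case (Suc n)
  show ?case
  proof (rule Suc.IH)
    fix \<tau> :: "nat \<Rightarrow> tm"
    have "Forall (subst (lift_sub (\<lambda>i. \<tau> (Suc i))) ((Forall ^^ n) A)) \<in> H"
      using Suc.prems[of "\<lambda>i. \<tau> (Suc i)"] by simp
    then have "subst (case_nat (\<tau> 0) (\<lambda>i. \<tau> (Suc i))) ((Forall ^^ n) A) \<in> H"
      by (simp add: Forall_iff inst_subst_lift)
    moreover have "case_nat (\<tau> 0) (\<lambda>i. \<tau> (Suc i)) = \<tau>"
      by (rule ext) (simp split: nat.split)
    ultimately show "subst \<tau> ((Forall ^^ n) A) \<in> H" by simp
  qed
qed simp

lemma subst_univ_closure_mem: "univ_closure A \<in> T \<Longrightarrow> subst \<sigma> A \<in> H"
  by (rule subst_Forall_funpow_mem[where n = "LEAST n. \<forall>k\<in>fv A. k < n"])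
    (use subst_sentence[OF fv_univ_closure[of A]] axioms in \<open>auto simp: univ_closure_def\<close>)

definition Eq_class :: "tm \<Rightarrow> tm set" where
  "Eq_class t = {s. Eq t s \<in> H}"

lemma Eq_class_eq_iff: "Eq_class s = Eq_class t \<longleftrightarrow> Eq s t \<in> H"
  unfolding Eq_class_def using Eq_refl Eq_sym Eq_trans by blast

text \<open>The quotient of terms by equality in \<open>H\<close> enters only through a surjection
  \<open>val\<close>, which leaves the carrier type free; it becomes \<open>nat\<close> in
  \<open>model_exists\<close>.\<close>

lemma truth_lemma:
  fixes val :: "tm \<Rightarrow> 'a"
  assumes surj: "surj val" and val: "\<And>s t. val s = val t \<longleftrightarrow> Eq s t \<in> H"
  shows "\<exists>M P. \<forall>\<sigma> A. sat M P (\<lambda>i. val (\<sigma> i)) A \<longleftrightarrow> subst \<sigma> A \<in> H"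
proof -
  define rep where "rep = inv val"
  have val_rep [simp]: "val (rep x) = x" for x
    unfolding rep_def by (rule surj_f_inv_f[OF surj])
  have rep_val: "Eq (rep (val t)) t \<in> H" "Eq t (rep (val t)) \<in> H" for t
    by (simp_all flip: val)
  define M where "M = \<lparr>zer = val Zero, sc = \<lambda>x. val (Succ (rep x)),
    ad = \<lambda>x y. val (Add (rep x) (rep y)), mu = \<lambda>x y. val (Mul (rep x) (rep y)),
    ls = \<lambda>x y. Less (rep x) (rep y) \<in> H\<rparr>"
  define P where "P = (\<lambda>p x. Pred p (rep x) \<in> H)"
  have eval: "eval M (\<lambda>i. val (\<sigma> i)) t = val (subst_tm \<sigma> t)" for \<sigma> t
    by (induction t)
      (auto simp: M_def val intro: rep_val Eq_Succ Eq_Add Eq_Mul)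
  have less: "ls M (val s) (val t) \<longleftrightarrow> Less s t \<in> H" for s t
    unfolding M_def using rep_val by (auto intro: Less_cong)
  have pred: "P p (val t) \<longleftrightarrow> Pred p t \<in> H" for p t
    unfolding P_def using rep_val by (blast intro: Pred_cong)
  have ex_val: "(\<forall>x. Q x) \<longleftrightarrow> (\<forall>t. Q (val t))" for Q
    by (metis val_rep)
  have case_val: "case_nat (val t) (\<lambda>i. val (\<sigma> i)) = (\<lambda>i. val (case_nat t \<sigma> i))" for t \<sigma>
    by (rule ext) (simp split: nat.split)
  have "sat M P (\<lambda>i. val (\<sigma> i)) A \<longleftrightarrow> subst \<sigma> A \<in> H" for \<sigma> A
  proof (induction A arbitrary: \<sigma>)
    case (Neq s t)
    then show ?case using neg_iff[of "Eq (subst_tm \<sigma> s) (subst_tm \<sigma> t)"] by (simp add: eval val)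
  next
    case (NLess s t)
    then show ?case using neg_iff[of "Less (subst_tm \<sigma> s) (subst_tm \<sigma> t)"] by (simp add: eval less)
  next
    case (NPred p t)
    then show ?case using neg_iff[of "Pred p (subst_tm \<sigma> t)"] by (simp add: eval pred)
  next
    case (Forall A)
    then show ?case by (simp add: ex_val case_val Forall_iff inst_subst_lift)
  next
    case (Exists A)
    have "(\<exists>x. sat M P (case_nat x (\<lambda>i. val (\<sigma> i))) A)
      \<longleftrightarrow> (\<exists>t. sat M P (case_nat (val t) (\<lambda>i. val (\<sigma> i))) A)"
      by (metis val_rep)
    with Exists show ?case by (simp add: case_val Exists_iff inst_subst_lift)
  qed (simp_all add: eval val less pred Conj_iff Disj_iff)
  then show ?thesis by blast
qed

text \<open>The axioms for \<open>Succ\<close> make the numerals pairwise inequivalent. The set of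
  term classes is therefore infinite as well as countable, and a bijection moves the term model to
  \<open>nat\<close>.\<close>

lemma model_exists:
  assumes T: "T = univ_closure ` Ax" and Ax: "arith_axioms \<subseteq> Ax"
  shows "\<exists>(M :: nat arith) P e. (\<forall>A\<in>Ax. \<forall>e. sat M P e A) \<and> (\<forall>A\<in>H. sat M P e A)"
proof -
  have arith: "subst \<sigma> A \<in> H" if "A \<in> arith_axioms" for A \<sigma>
    using subst_univ_closure_mem that T Ax by blast
  have Succ_Zero: "Eq (Succ t) Zero \<notin> H" for t
    using arith[of "Neq (Succ (Var 0)) Zero" "\<lambda>_. t"] neg_iff[of "Eq (Succ t) Zero"]
    by (simp add: arith_axioms_def)
  have Succ_inj: "Eq s t \<in> H" if "Eq (Succ s) (Succ t) \<in> H" for s t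
  proof -
    have "subst (case_nat s (\<lambda>_. t))
        (Imp (Eq (Succ (Var 0)) (Succ (Var 1))) (Eq (Var 0) (Var 1))) \<in> H"
      by (rule arith) (simp add: arith_axioms_def)
    then show ?thesis
      using that neg_iff[of "Eq (Succ s) (Succ t)"] by (simp add: Imp_def Disj_iff)
  qed
  have "inj (\<lambda>n. Eq_class ((Succ ^^ n) Zero))"
  proof (rule injI)
    fix m n :: nat
    assume "Eq_class ((Succ ^^ m) Zero) = Eq_class ((Succ ^^ n) Zero)"
    then have "Eq ((Succ ^^ m) Zero) ((Succ ^^ n) Zero) \<in> H" by (simp add: Eq_class_eq_iff)
    then show "m = n"
    proof (induction m arbitrary: n)
      case 0
      then show ?case using Succ_Zero Eq_sym by (cases n) auto
    next
      case (Suc m)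
      then show ?case using Succ_Zero Succ_inj by (cases n) auto
    qed
  qed
  then have "infinite (range (\<lambda>n. Eq_class ((Succ ^^ n) Zero)))"
    by (rule range_inj_infinite)
  then have "infinite (range Eq_class)"
    by (rule contrapos_nn) (auto elim: finite_subset[rotated])
  moreover have "countable (range Eq_class)" by simp
  ultimately obtain f :: "tm set \<Rightarrow> nat" where f: "bij_betw f (range Eq_class) UNIV"
    using countableE_infinite by blast
  define val where "val t = f (Eq_class t)" for t
  have "surj val"
    using bij_betw_imp_surj_on[OF f] by (simp add: val_def[abs_def] image_image)
  moreover have "val s = val t \<longleftrightarrow> Eq s t \<in> H" for s t
    using inj_on_eq_iff[OF bij_betw_imp_inj_on[OF f] rangeI rangeI, of s t]
    by (simp add: val_def Eq_class_eq_iff)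
  ultimately obtain M P where sat: "\<And>\<sigma> A. sat M P (\<lambda>i. val (\<sigma> i)) A \<longleftrightarrow> subst \<sigma> A \<in> H"
    using truth_lemma by blast
  have "sat M P e A" if "A \<in> Ax" for e A
  proof -
    have "sat M P (\<lambda>i. val (inv val (e i))) A"
      using subst_univ_closure_mem that T by (simp add: sat)
    then show ?thesis using \<open>surj val\<close> by (simp add: surj_f_inv_f)
  qed
  moreover have "sat M P (\<lambda>i. val (Var i)) A" if "A \<in> H" for A
    using sat[of Var A] that by simp
  ultimately show ?thesis by blast
qed

end

theorem completeness:
  fixes Ax :: "'p::countable fm set"
  assumes "\<not> provable (univ_closure ` Ax) A" and "arith_axioms \<subseteq> Ax"
  shows "\<exists>(M :: nat arith) P e. (\<forall>B\<in>Ax. \<forall>e. sat M P e B) \<and> \<not> sat M P e A"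
proof -
  have "\<exists>H. henkin_set (univ_closure ` Ax) H \<and> neg A \<in> H"
    by (rule henkin_set_exists) (use assms(1) in \<open>auto simp: inconsistent_neg fv_univ_closure\<close>)
  then obtain H where H: "henkin_set (univ_closure ` Ax) H" "neg A \<in> H" by blast
  obtain M :: "nat arith" and P e where "\<forall>B\<in>Ax. \<forall>e. sat M P e B" "\<forall>B\<in>H. sat M P e B"
    using henkin_set.model_exists[OF H(1) refl assms(2)] by blast
  then show ?thesis using H(2) sat_neg[of M P e A] by blast
qed

section \<open>Satisfaction and free variables, substitution for the predicate
  \<open>X\<close>\<close>

lemma eval_cong: "(\<And>i. i \<in> fv_tm t \<Longrightarrow> e i = e' i) \<Longrightarrow> eval M e t = eval M e' t"
  by (induction t) auto

lemma sat_cong: "(\<And>i. i \<in> fv A \<Longrightarrow> e i = e' i) \<Longrightarrow> sat M P e A \<longleftrightarrow> sat M P e' A"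
proof (induction A arbitrary: e e')
  case (Forall A)
  have "sat M P (case_nat x e) A \<longleftrightarrow> sat M P (case_nat x e') A" for x
    by (rule Forall.IH) (use Forall.prems in \<open>auto split: nat.split\<close>)
  then show ?case by simp
next
  case (Exists A)
  have "sat M P (case_nat x e) A \<longleftrightarrow> sat M P (case_nat x e') A" for x
    by (rule Exists.IH) (use Exists.prems in \<open>auto split: nat.split\<close>)
  then show ?case by simp
next
  case (Conj A B)
  have "sat M P e A \<longleftrightarrow> sat M P e' A" "sat M P e B \<longleftrightarrow> sat M P e' B"
    by (rule Conj.IH; use Conj.prems in simp)+
  then show ?case by simp
next
  case (Disj A B)
  have "sat M P e A \<longleftrightarrow> sat M P e' A" "sat M P e B \<longleftrightarrow> sat M P e' B"
    by (rule Disj.IH; use Disj.prems in simp)+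
  then show ?case by simp
next
  case (Eq s t)
  have "eval M e s = eval M e' s" "eval M e t = eval M e' t"
    by (rule eval_cong; use Eq.prems in simp)+
  then show ?case by simp
next
  case (Neq s t)
  have "eval M e s = eval M e' s" "eval M e t = eval M e' t"
    by (rule eval_cong; use Neq.prems in simp)+
  then show ?case by simp
next
  case (Less s t)
  have "eval M e s = eval M e' s" "eval M e t = eval M e' t"
    by (rule eval_cong; use Less.prems in simp)+
  then show ?case by simp
next
  case (NLess s t)
  have "eval M e s = eval M e' s" "eval M e t = eval M e' t"
    by (rule eval_cong; use NLess.prems in simp)+
  then show ?case by simp
next
  case (Pred p t)
  have "eval M e t = eval M e' t"
    by (rule eval_cong) (use Pred.prems in simp)
  then show ?case by simp
next
  case (NPred p t)
  have "eval M e t = eval M e' t"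
    by (rule eval_cong) (use NPred.prems in simp)
  then show ?case by simp
qed

lemma sat_plug:
  "sat M P e (plug d \<psi> A) \<longleftrightarrow>
   sat M (\<lambda>_ z. sat M P (case_nat z (\<lambda>k. e (Suc k + d))) \<psi>) e A"
proof -
  have "(\<lambda>i. eval M e (case_nat t (\<lambda>k. Var (Suc (k + d))) i))
      = case_nat (eval M e t) (\<lambda>k. e (Suc (k + d)))" for t e d
    by (rule ext) (simp split: nat.split)
  then show ?thesis
    by (induction A arbitrary: d e) (simp_all add: sat_subst)
qed

lemma fv_tm_subst_tm: "fv_tm (subst_tm \<sigma> t) = (\<Union>i\<in>fv_tm t. fv_tm (\<sigma> i))"
  by (induction t) auto

lemma fv_subst: "fv (subst \<sigma> A) \<subseteq> (\<Union>i\<in>fv A. fv_tm (\<sigma> i))"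
proof -
  have lift: "{n. Suc n \<in> (\<Union>i\<in>N. fv_tm (lift_sub \<sigma> i))} \<subseteq> (\<Union>i\<in>{n. Suc n \<in> N}. fv_tm (\<sigma> i))"
    for N \<sigma>
  proof (rule subsetI, clarsimp)
    fix x i assume "i \<in> N" "Suc x \<in> fv_tm (lift_sub \<sigma> i)"
    then show "\<exists>i. Suc i \<in> N \<and> x \<in> fv_tm (\<sigma> i)"
      by (cases i) (auto simp: lift_sub_def fv_tm_subst_tm)
  qed
  show ?thesis
  proof (induction A arbitrary: \<sigma>)
    case (Forall A)
    then show ?case using lift[of \<sigma> "fv A"] by fastforce
  next
    case (Exists A)
    then show ?case using lift[of \<sigma> "fv A"] by fastforce
  qed (fastforce simp: fv_tm_subst_tm)+
qed

lemma pos_in_X_subst [simp]: "pos_in_X (subst \<sigma> A) = pos_in_X A"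
  by (induction A arbitrary: \<sigma>) auto

section \<open>Semantics of second order arithmetic\<close>

text \<open>Henkin semantics: \<open>\<S>\<close> is an arbitrary family of sets, later that of the
  definable ones.\<close>

primrec sat2 :: "'a arith \<Rightarrow> 'a set set \<Rightarrow> (nat \<Rightarrow> 'a) \<Rightarrow> (nat \<Rightarrow> 'a set) \<Rightarrow> fm2 \<Rightarrow> bool" where
  "sat2 M \<S> e V (Eq2 s t) \<longleftrightarrow> eval M e s = eval M e t"
| "sat2 M \<S> e V (Neq2 s t) \<longleftrightarrow> eval M e s \<noteq> eval M e t"
| "sat2 M \<S> e V (Less2 s t) \<longleftrightarrow> ls M (eval M e s) (eval M e t)"
| "sat2 M \<S> e V (NLess2 s t) \<longleftrightarrow> \<not> ls M (eval M e s) (eval M e t)"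
| "sat2 M \<S> e V (Mem t X) \<longleftrightarrow> eval M e t \<in> V X"
| "sat2 M \<S> e V (NMem t X) \<longleftrightarrow> eval M e t \<notin> V X"
| "sat2 M \<S> e V (Conj2 A B) \<longleftrightarrow> sat2 M \<S> e V A \<and> sat2 M \<S> e V B"
| "sat2 M \<S> e V (Disj2 A B) \<longleftrightarrow> sat2 M \<S> e V A \<or> sat2 M \<S> e V B"
| "sat2 M \<S> e V (Forall2 A) \<longleftrightarrow> (\<forall>x. sat2 M \<S> (case_nat x e) V A)"
| "sat2 M \<S> e V (Exists2 A) \<longleftrightarrow> (\<exists>x. sat2 M \<S> (case_nat x e) V A)"
| "sat2 M \<S> e V (ForallS A) \<longleftrightarrow> (\<forall>X\<in>\<S>. sat2 M \<S> e (case_nat X V) A)"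
| "sat2 M \<S> e V (ExistsS A) \<longleftrightarrow> (\<exists>X\<in>\<S>. sat2 M \<S> e (case_nat X V) A)"

lemma sat2_neg2 [simp]: "sat2 M \<S> e V (neg2 A) \<longleftrightarrow> \<not> sat2 M \<S> e V A"
  by (induction A arbitrary: e V) auto

lemma sat2_Imp2 [simp]: "sat2 M \<S> e V (Imp2 A B) \<longleftrightarrow> (sat2 M \<S> e V A \<longrightarrow> sat2 M \<S> e V B)"
  by (simp add: Imp2_def)

lemma sat2_Iff2 [simp]: "sat2 M \<S> e V (Iff2 A B) \<longleftrightarrow> (sat2 M \<S> e V A \<longleftrightarrow> sat2 M \<S> e V B)"
  by (auto simp: Iff2_def)

lemma sat2_substn2:
  "sat2 M \<S> e V (substn2 \<sigma> A) \<longleftrightarrow> sat2 M \<S> (\<lambda>i. eval M e (\<sigma> i)) V A"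
  by (induction A arbitrary: e V \<sigma>) (auto simp: eval_subst_tm eval_lift_sub)

lemma sat2_renS: "sat2 M \<S> e V (renS \<rho> A) \<longleftrightarrow> sat2 M \<S> e (\<lambda>X. V (\<rho> X)) A"
proof -
  have *: "(\<lambda>Y. case_nat X V (case_nat 0 (\<lambda>X. Suc (\<rho> X)) Y)) = case_nat X (\<lambda>X. V (\<rho> X))" for X V \<rho>
    by (rule ext) (simp split: nat.split)
  show ?thesis by (induction A arbitrary: e V \<rho>) (simp_all add: *)
qed

lemma sat2_shiftS [simp]: "sat2 M \<S> e (case_nat X V) (shiftS A) \<longleftrightarrow> sat2 M \<S> e V A"
  by (simp add: shiftS_def sat2_renS)

lemma sat2_shiftn2 [simp]: "sat2 M \<S> (case_nat x e) V (shiftn2 A) \<longleftrightarrow> sat2 M \<S> e V A"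
  by (simp add: shiftn2_def sat2_substn2)

lemma sat2_instn2 [simp]: "sat2 M \<S> e V (instn2 t A) \<longleftrightarrow> sat2 M \<S> (case_nat (eval M e t) e) V A"
proof -
  have "(\<lambda>i. eval M e (case_nat t Var i)) = case_nat (eval M e t) e"
    by (rule ext) (simp split: nat.split)
  then show ?thesis by (simp add: instn2_def sat2_substn2)
qed

lemma sat2_instS [simp]: "sat2 M \<S> e V (instS X A) \<longleftrightarrow> sat2 M \<S> e (case_nat (V X) V) A"
proof -
  have "(\<lambda>Y. V (case_nat X (\<lambda>Y. Y) Y)) = case_nat (V X) V"
    by (rule ext) (simp split: nat.split)
  then show ?thesis by (simp add: instS_def sat2_renS)
qed

lemma sat2_to_fm2: "sat2 M \<S> e V (to_fm2 Y A) \<longleftrightarrow> sat M (\<lambda>p x. x \<in> V (Y p)) e A"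
  by (induction A arbitrary: e) auto

text \<open>The witnesses in \<open>ExistsSR2\<close> are set variables, so it is enough that
  \<open>\<S>\<close> contains their values; closure of \<open>\<S>\<close> under definability is
  left to the comprehension axioms.\<close>

lemma tait2_sound:
  assumes "tait2 \<Gamma>" and "\<And>X. V X \<in> \<S>"
  shows "\<exists>A\<in>\<Gamma>. sat2 M \<S> e V A"
  using assms
proof (induction arbitrary: e V rule: tait2.induct)
  case (Ax2 A \<Gamma>)
  then show ?case using sat2_neg2 by blast
next
  case (EqRefl2 t \<Gamma>)
  then show ?case by (intro bexI[of _ "Eq2 t t"]) simp_all
next
  case (EqSubst2 s t \<Gamma> A)
  have "sat2 M \<S> e V (Neq2 s t) \<or> sat2 M \<S> e V (neg2 (instn2 s A)) \<or> sat2 M \<S> e V (instn2 t A)"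
    by auto
  with EqSubst2 show ?case by blast
next
  case (ConjR2 A \<Gamma> B)
  show ?case using ConjR2.IH(1)[of V e, OF ConjR2.prems] ConjR2.IH(2)[of V e, OF ConjR2.prems] by auto
next
  case (DisjR2 A B \<Gamma>)
  show ?case using DisjR2.IH[of V e, OF DisjR2.prems] by auto
next
  case (ForallR2 A \<Gamma>)
  show ?case
  proof (cases "\<exists>B\<in>\<Gamma>. sat2 M \<S> e V B")
    case False
    have "sat2 M \<S> (case_nat x e) V A" for x
      using ForallR2.IH[of V "case_nat x e"] ForallR2.prems False by auto
    then show ?thesis by simp
  qed auto
next
  case (ExistsR2 t A \<Gamma>)
  show ?case using ExistsR2.IH[of V e, OF ExistsR2.prems] by auto
next
  case (ForallSR2 A \<Gamma>)
  show ?case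
  proof (cases "\<exists>B\<in>\<Gamma>. sat2 M \<S> e V B")
    case False
    have "sat2 M \<S> e (case_nat X V) A" if "X \<in> \<S>" for X
    proof -
      have "case_nat X V Y \<in> \<S>" for Y
        using that ForallSR2.prems by (simp split: nat.split)
      then show ?thesis
        using ForallSR2.IH[of "case_nat X V" e] False by auto
    qed
    then show ?thesis by simp
  qed auto
next
  case (ExistsSR2 X A \<Gamma>)
  show ?case using ExistsSR2.IH[of V e, OF ExistsSR2.prems] ExistsSR2.prems[of X] by auto
next
  case (Cut2 A \<Gamma>)
  show ?case using Cut2.IH(1)[of V e, OF Cut2.prems] Cut2.IH(2)[of V e, OF Cut2.prems] by auto
qed

lemma sat2_univ_closure2:
  assumes "\<And>e V. (\<And>X. V X \<in> \<S>) \<Longrightarrow> sat2 M \<S> e V A" and "\<And>X. V X \<in> \<S>"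
  shows "sat2 M \<S> e V (univ_closure2 A)"
proof -
  have n: "sat2 M \<S> e V ((Forall2 ^^ n) A)" if "\<And>X. V X \<in> \<S>" for n e V
    using that assms(1) by (induction n arbitrary: e) simp_all
  have "sat2 M \<S> e V ((ForallS ^^ m) ((Forall2 ^^ n) A))" if "\<And>X. V X \<in> \<S>" for m n V
    using that
  proof (induction m arbitrary: V)
    case (Suc m)
    have "sat2 M \<S> e (case_nat X V) ((ForallS ^^ m) ((Forall2 ^^ n) A))" if "X \<in> \<S>" for X
      by (rule Suc.IH) (use that Suc.prems in \<open>simp split: nat.split\<close>)
    then show ?case by simp
  qed (simp add: n)
  then show ?thesis using assms(2) by (simp add: univ_closure2_def)
qed

section \<open>Definability in a model of the theory of inductive definitions\<close>

text \<open>The axioms hold under every environment, which replaces their universal closures and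
  makes induction and (L) available with parameters from the model.\<close>

locale id_model =
  fixes M :: "'a arith" and P :: "opform \<Rightarrow> 'a \<Rightarrow> bool" and nm :: "nat \<Rightarrow> 'a"
  assumes surj_nm: "surj nm"
    and arith: "A \<in> arith_axioms \<Longrightarrow> sat M P e A"
    and induction: "sat M P e (induction_axiom A)"
    and fixpoint: "sat M P e (fixpoint_axiom \<phi>)"
    and least: "sat M P e (least_axiom \<phi> A)"
begin

text \<open>
  Parameters from the model are made available as the odd variables, which enumerate the
  (countable) carrier; a definable predicate of environments only sees its environment through the
  even variables.
\<close>

definition mix :: "(nat \<Rightarrow> 'a) \<Rightarrow> nat \<Rightarrow> 'a" where
  "mix e i = (if even i then e (i div 2) else nm (i div 2))"

definition def_term :: "((nat \<Rightarrow> 'a) \<Rightarrow> 'a) \<Rightarrow> bool" where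
  "def_term f \<longleftrightarrow> (\<exists>t. \<forall>e. eval M (mix e) t = f e)"

text \<open>HOL predicates of environments stand in for formulas, so that definability follows by
  the closure rules \<open>def_intros\<close> and no de Bruijn formula has to be written
  out.\<close>

definition def_pred :: "((nat \<Rightarrow> 'a) \<Rightarrow> bool) \<Rightarrow> bool" where
  "def_pred Q \<longleftrightarrow> (\<exists>A. \<forall>e. sat M P (mix e) A = Q e)"

lemma def_term_var: "def_term (\<lambda>e. e n)"
  unfolding def_term_def by (intro exI[of _ "Var (2 * n)"]) (simp add: mix_def)

lemma def_term_const: "def_term (\<lambda>e. c)"
proof -
  obtain n where "c = nm n" using surj_nm by auto
  then show ?thesis
    unfolding def_term_def by (intro exI[of _ "Var (2 * n + 1)"]) (simp add: mix_def)
qed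

lemma def_term_sc: "def_term f \<Longrightarrow> def_term (\<lambda>e. sc M (f e))"
  unfolding def_term_def by (metis eval.simps(3))

lemma def_term_ad: "def_term f \<Longrightarrow> def_term g \<Longrightarrow> def_term (\<lambda>e. ad M (f e) (g e))"
  unfolding def_term_def by (metis eval.simps(4))

lemma def_term_mu: "def_term f \<Longrightarrow> def_term g \<Longrightarrow> def_term (\<lambda>e. mu M (f e) (g e))"
  unfolding def_term_def by (metis eval.simps(5))

lemma def_pred_eq: "def_term f \<Longrightarrow> def_term g \<Longrightarrow> def_pred (\<lambda>e. f e = g e)"
  unfolding def_term_def def_pred_def by (metis sat.simps(1))

lemma def_pred_ls: "def_term f \<Longrightarrow> def_term g \<Longrightarrow> def_pred (\<lambda>e. ls M (f e) (g e))"
  unfolding def_term_def def_pred_def by (metis sat.simps(3))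

lemma def_pred_P: "def_term f \<Longrightarrow> def_pred (\<lambda>e. P \<phi> (f e))"
  unfolding def_term_def def_pred_def by (metis sat.simps(5))

lemma def_pred_not: "def_pred Q \<Longrightarrow> def_pred (\<lambda>e. \<not> Q e)"
  unfolding def_pred_def by (metis sat_neg)

lemma def_pred_conj: "def_pred Q \<Longrightarrow> def_pred R \<Longrightarrow> def_pred (\<lambda>e. Q e \<and> R e)"
  unfolding def_pred_def by (metis sat.simps(7))

lemma def_pred_disj: "def_pred Q \<Longrightarrow> def_pred R \<Longrightarrow> def_pred (\<lambda>e. Q e \<or> R e)"
  unfolding def_pred_def by (metis sat.simps(8))

lemma def_pred_imp: "def_pred Q \<Longrightarrow> def_pred R \<Longrightarrow> def_pred (\<lambda>e. Q e \<longrightarrow> R e)"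
  unfolding def_pred_def by (metis sat_Imp)

lemma def_pred_const: "def_pred (\<lambda>e. b)"
  using def_pred_eq[OF def_term_var def_term_var, of 0 0]
    def_pred_not[OF def_pred_eq[OF def_term_var def_term_var, of 0 0]]
  by (cases b) simp_all

lemma def_pred_subst:
  assumes "def_pred Q" and "\<And>i. def_term (F i)"
  shows "def_pred (\<lambda>e. Q (\<lambda>i. F i e))"
proof -
  obtain A where A: "\<And>e. sat M P (mix e) A = Q e" using assms(1) by (auto simp: def_pred_def)
  obtain t where t: "\<And>i e. eval M (mix e) (t i) = F i e"
    using assms(2) unfolding def_term_def by metis
  \<comment> \<open>Only the even variables, which carry the environment, are replaced; the odd ones
    must keep naming parameters.\<close>
  define \<sigma> where "\<sigma> i = (if even i then t (i div 2) else Var i)" for i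
  have "(\<lambda>i. eval M (mix e) (\<sigma> i)) = mix (\<lambda>i. F i e)" for e
    by (rule ext) (auto simp: \<sigma>_def t mix_def)
  then have "sat M P (mix e) (subst \<sigma> A) = Q (\<lambda>i. F i e)" for e
    by (simp add: sat_subst A)
  then show ?thesis unfolding def_pred_def by blast
qed

lemma def_pred_all:
  assumes "def_pred (\<lambda>e. Q (e 0) (\<lambda>i. e (Suc i)))"
  shows "def_pred (\<lambda>e. \<forall>x. Q x e)"
proof -
  obtain A where A: "\<And>e. sat M P (mix e) A = Q (e 0) (\<lambda>i. e (Suc i))"
    using assms by (auto simp: def_pred_def)
  \<comment> \<open>A quantifier moves all variables by one, but extending the environment inside
    \<open>mix\<close> moves the even ones by two and fixes the odd ones. Hence an even
    \<open>Suc j\<close> is lowered to \<open>j\<close>, and an odd \<open>Suc j\<close> is raised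
    to \<open>Suc (Suc j)\<close>.\<close>
  define \<rho> where "\<rho> i = (case i of 0 \<Rightarrow> Var 0 | Suc j \<Rightarrow> if even j then Var (Suc (Suc j)) else Var j)"
    for i
  have "(\<lambda>i. eval M (case_nat x (mix e)) (\<rho> i)) = mix (case_nat x e)" for x e
  proof
    fix i show "eval M (case_nat x (mix e)) (\<rho> i) = mix (case_nat x e) i"
    proof (cases i)
      case (Suc j)
      then show ?thesis
        by (cases j) (auto simp: \<rho>_def mix_def split: nat.split)
    qed (simp add: \<rho>_def mix_def)
  qed
  then have "sat M P (mix e) (Forall (subst \<rho> A)) = (\<forall>x. Q x e)" for e
    by (simp add: sat_subst A)
  then show ?thesis unfolding def_pred_def by blast
qed

lemma def_pred_ex:
  assumes "def_pred (\<lambda>e. Q (e 0) (\<lambda>i. e (Suc i)))"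
  shows "def_pred (\<lambda>e. \<exists>x. Q x e)"
  using def_pred_not[OF def_pred_all[of "\<lambda>x e. \<not> Q x e", OF def_pred_not[OF assms]]] by simp

lemma def_pred_finite_ex:
  assumes "finite C" and "\<And>c. c \<in> C \<Longrightarrow> def_pred (Q c)"
  shows "def_pred (\<lambda>e. \<exists>c\<in>C. Q c e)"
  using assms by (induction C) (auto intro: def_pred_const def_pred_disj)

lemma def_pred_app1: "def_pred (\<lambda>e. R (e 0)) \<Longrightarrow> def_term f \<Longrightarrow> def_pred (\<lambda>e. R (f e))"
  using def_pred_subst[of "\<lambda>e. R (e 0)" "\<lambda>_. f"] by simp

lemma def_pred_app2:
  assumes "def_pred (\<lambda>e. R (e 0) (e 1))" and "def_term f" and "def_term g"
  shows "def_pred (\<lambda>e. R (f e) (g e))"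
  using def_pred_subst[of "\<lambda>e. R (e 0) (e 1)" "\<lambda>i. if i = 0 then f else g"] assms by simp

lemma def_pred_app3:
  assumes "def_pred (\<lambda>e. R (e 0) (e 1) (e 2))" and "def_term f" and "def_term g" and "def_term h"
  shows "def_pred (\<lambda>e. R (f e) (g e) (h e))"
  using def_pred_subst[of "\<lambda>e. R (e 0) (e 1) (e 2)" "\<lambda>i. if i = 0 then f else if i = 1 then g else h"]
    assms by simp

lemmas def_intros = def_term_sc def_term_ad def_term_mu def_term_var def_term_const
  def_pred_const def_pred_not def_pred_conj def_pred_disj def_pred_imp def_pred_all def_pred_ex
  def_pred_eq def_pred_ls def_pred_P

lemma def_term_eval: "def_term (\<lambda>e. eval M e t)"
  by (induction t) (simp_all add: def_intros)

lemma def_pred_sat: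
  assumes "def_pred (\<lambda>e. X (e 0))"
  shows "def_pred (\<lambda>e. sat M (\<lambda>_. X) e A)"
proof (induction A)
  case (Forall A)
  have "(\<lambda>e. sat M (\<lambda>_. X) (case_nat (e 0) (\<lambda>i. e (Suc i))) A) = (\<lambda>e. sat M (\<lambda>_. X) e A)"
    by (rule ext, rule sat_cong) (simp split: nat.split)
  with Forall show ?case by (auto intro!: def_pred_all)
next
  case (Exists A)
  have "(\<lambda>e. sat M (\<lambda>_. X) (case_nat (e 0) (\<lambda>i. e (Suc i))) A) = (\<lambda>e. sat M (\<lambda>_. X) e A)"
    by (rule ext, rule sat_cong) (simp split: nat.split)
  with Exists show ?case by (auto intro!: def_pred_ex)
qed (simp_all add: def_intros def_term_eval def_pred_app1[OF assms])

lemma def_predE: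
  assumes "def_pred (\<lambda>e. Q (e 0))"
  obtains A e where "\<And>x. sat M P (case_nat x e) A = Q x"
proof -
  obtain A where A: "\<And>e. sat M P (mix e) A = Q (e 0)"
    using assms by (auto simp: def_pred_def)
  \<comment> \<open>The odd variables keep the parameters; the even ones besides variable 0 get the
    default \<open>zer M\<close>, as only \<open>e 0\<close> matters to \<open>Q\<close>.\<close>
  define e where "e i = mix (\<lambda>_. zer M) (Suc i)" for i
  have "case_nat x e = mix (case_nat x (\<lambda>_. zer M))" for x
  proof
    fix i show "case_nat x e i = mix (case_nat x (\<lambda>_. zer M)) i"
      by (cases i) (auto simp: e_def mix_def split: nat.split)
  qed
  then have "sat M P (case_nat x e) A = Q x" for x by (simp add: A)
  then show thesis by (rule that)
qed

section \<open>Induction, (F) and (L) as principles about the model\<close>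

lemma induct:
  assumes "def_pred (\<lambda>e. Q (e 0))" and "Q (zer M)" and "\<And>x. Q x \<Longrightarrow> Q (sc M x)"
  shows "Q x"
proof -
  obtain A e where A: "\<And>x. sat M P (case_nat x e) A = Q x"
    using def_predE[OF assms(1)] by blast
  have "(\<lambda>i. eval M e (case_nat Zero Var i)) = case_nat (zer M) e"
    by (rule ext) (simp split: nat.split)
  moreover have "(\<lambda>i. eval M (case_nat x e) (case_nat (Succ (Var 0)) (\<lambda>k. Var (Suc k)) i))
      = case_nat (sc M x) e" for x
    by (rule ext) (simp split: nat.split)
  ultimately show ?thesis
    using induction[of e A] assms(2,3) by (simp add: induction_axiom_def inst_def sat_subst A)
qed

lemma op_app_sat:
  "sat M P (case_nat x e) (op_app \<phi> A)
    \<longleftrightarrow> sat M (\<lambda>_ z. sat M P (case_nat z e) A) (\<lambda>_. x) (form_of \<phi>)"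
proof -
  have "fv (form_of \<phi>) \<subseteq> {0}" using form_of[of \<phi>] by auto
  then have "sat M (\<lambda>_ z. sat M P (case_nat z e) A) (case_nat x e) (form_of \<phi>)
    \<longleftrightarrow> sat M (\<lambda>_ z. sat M P (case_nat z e) A) (\<lambda>_. x) (form_of \<phi>)"
    by (intro sat_cong) auto
  then show ?thesis by (simp add: op_app_def sat_plug)
qed

lemma P_closed: "sat M (\<lambda>_. P \<phi>) (\<lambda>_. x) (form_of \<phi>) \<Longrightarrow> P \<phi> x"
  using fixpoint[of "\<lambda>_. x" \<phi>] by (simp add: fixpoint_axiom_def op_app_sat)

lemma P_least:
  assumes "def_pred (\<lambda>e. Q (e 0))" and "\<And>x. sat M (\<lambda>_. Q) (\<lambda>_. x) (form_of \<phi>) \<Longrightarrow> Q x"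
    and "P \<phi> x"
  shows "Q x"
proof -
  obtain A e where A: "\<And>x. sat M P (case_nat x e) A = Q x"
    using def_predE[OF assms(1)] by blast
  show ?thesis
    using least[of e \<phi> A] assms(2,3) by (simp add: least_axiom_def op_app_sat A)
qed

section \<open>Positive operators\<close>

text \<open>In contrast to \<open>def_term\<close>, no odd variables name parameters here, since an
  operator form admits none; only closed terms serve as constants.\<close>

definition pos_term :: "((nat \<Rightarrow> 'a) \<Rightarrow> 'a) \<Rightarrow> bool" where
  "pos_term f \<longleftrightarrow> (\<exists>t. \<forall>e. eval M e t = f e)"

definition pos_op :: "(('a \<Rightarrow> bool) \<Rightarrow> (nat \<Rightarrow> 'a) \<Rightarrow> bool) \<Rightarrow> bool" where
  "pos_op \<Phi> \<longleftrightarrow> (\<exists>A. pos_in_X A \<and> (\<forall>X e. sat M (\<lambda>_ :: unit. X) e A = \<Phi> X e))"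

text \<open>Positive operators are not closed under negation. Asking for positive formulas for both
  \<open>Q\<close> and its complement, with truth independent of \<open>X\<close>, gives a class
  closed under all connectives.\<close>

definition arith_pred :: "((nat \<Rightarrow> 'a) \<Rightarrow> bool) \<Rightarrow> bool" where
  "arith_pred Q \<longleftrightarrow> pos_op (\<lambda>X. Q) \<and> pos_op (\<lambda>X e. \<not> Q e)"

lemma pos_term_var: "pos_term (\<lambda>e. e n)"
  unfolding pos_term_def by (metis eval.simps(1))

lemma pos_term_zer: "pos_term (\<lambda>e. zer M)"
  unfolding pos_term_def by (metis eval.simps(2))

lemma pos_term_sc: "pos_term f \<Longrightarrow> pos_term (\<lambda>e. sc M (f e))"
  unfolding pos_term_def by (metis eval.simps(3))

lemma pos_term_ad: "pos_term f \<Longrightarrow> pos_term g \<Longrightarrow> pos_term (\<lambda>e. ad M (f e) (g e))"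
  unfolding pos_term_def by (metis eval.simps(4))

lemma pos_term_mu: "pos_term f \<Longrightarrow> pos_term g \<Longrightarrow> pos_term (\<lambda>e. mu M (f e) (g e))"
  unfolding pos_term_def by (metis eval.simps(5))

lemma pos_op_eq: "pos_term f \<Longrightarrow> pos_term g \<Longrightarrow> pos_op (\<lambda>X e. f e = g e)"
  unfolding pos_term_def pos_op_def by (metis sat.simps(1) pos_in_X.simps(1))

lemma pos_op_neq: "pos_term f \<Longrightarrow> pos_term g \<Longrightarrow> pos_op (\<lambda>X e. f e \<noteq> g e)"
  unfolding pos_term_def pos_op_def by (metis sat.simps(2) pos_in_X.simps(2))

lemma pos_op_ls: "pos_term f \<Longrightarrow> pos_term g \<Longrightarrow> pos_op (\<lambda>X e. ls M (f e) (g e))"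
  unfolding pos_term_def pos_op_def by (metis sat.simps(3) pos_in_X.simps(3))

lemma pos_op_nls: "pos_term f \<Longrightarrow> pos_term g \<Longrightarrow> pos_op (\<lambda>X e. \<not> ls M (f e) (g e))"
  unfolding pos_term_def pos_op_def by (metis sat.simps(4) pos_in_X.simps(4))

lemma pos_op_X: "pos_term f \<Longrightarrow> pos_op (\<lambda>X e. X (f e))"
  unfolding pos_term_def pos_op_def by (metis sat.simps(5) pos_in_X.simps(5))

lemma pos_op_conj: "pos_op \<Phi> \<Longrightarrow> pos_op \<Psi> \<Longrightarrow> pos_op (\<lambda>X e. \<Phi> X e \<and> \<Psi> X e)"
  unfolding pos_op_def by (metis sat.simps(7) pos_in_X.simps(7))

lemma pos_op_disj: "pos_op \<Phi> \<Longrightarrow> pos_op \<Psi> \<Longrightarrow> pos_op (\<lambda>X e. \<Phi> X e \<or> \<Psi> X e)"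
  unfolding pos_op_def by (metis sat.simps(8) pos_in_X.simps(8))

lemma pos_op_all:
  assumes "pos_op (\<lambda>X e. \<Phi> X (e 0) (\<lambda>i. e (Suc i)))"
  shows "pos_op (\<lambda>X e. \<forall>x. \<Phi> X x e)"
proof -
  obtain A where "pos_in_X A" "\<And>X e. sat M (\<lambda>_ :: unit. X) e A = \<Phi> X (e 0) (\<lambda>i. e (Suc i))"
    using assms by (auto simp: pos_op_def)
  then show ?thesis unfolding pos_op_def by (intro exI[of _ "Forall A"]) simp
qed

lemma pos_op_ex:
  assumes "pos_op (\<lambda>X e. \<Phi> X (e 0) (\<lambda>i. e (Suc i)))"
  shows "pos_op (\<lambda>X e. \<exists>x. \<Phi> X x e)"
proof -
  obtain A where "pos_in_X A" "\<And>X e. sat M (\<lambda>_ :: unit. X) e A = \<Phi> X (e 0) (\<lambda>i. e (Suc i))"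
    using assms by (auto simp: pos_op_def)
  then show ?thesis unfolding pos_op_def by (intro exI[of _ "Exists A"]) simp
qed

lemma pos_op_subst:
  assumes "pos_op \<Phi>" and "\<And>i. pos_term (F i)"
  shows "pos_op (\<lambda>X e. \<Phi> X (\<lambda>i. F i e))"
proof -
  obtain A where "pos_in_X A" "\<And>X e. sat M (\<lambda>_ :: unit. X) e A = \<Phi> X e"
    using assms(1) by (auto simp: pos_op_def)
  moreover obtain t where "\<And>i e. eval M e (t i) = F i e"
    using assms(2) unfolding pos_term_def by metis
  ultimately show ?thesis
    unfolding pos_op_def by (intro exI[of _ "subst t A"]) (simp add: sat_subst)
qed

lemma pos_op_const: "pos_op (\<lambda>X e. b)"
  using pos_op_eq[OF pos_term_var pos_term_var, of 0 0]
    pos_op_neq[OF pos_term_var pos_term_var, of 0 0]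
  by (cases b) simp_all

lemma arith_pred_pos: "arith_pred Q \<Longrightarrow> pos_op (\<lambda>X e. Q e)"
  by (simp add: arith_pred_def)

lemma arith_pred_const: "arith_pred (\<lambda>e. b)"
  by (simp add: arith_pred_def pos_op_const)

lemma arith_pred_eq: "pos_term f \<Longrightarrow> pos_term g \<Longrightarrow> arith_pred (\<lambda>e. f e = g e)"
  by (simp add: arith_pred_def pos_op_eq pos_op_neq)

lemma arith_pred_ls: "pos_term f \<Longrightarrow> pos_term g \<Longrightarrow> arith_pred (\<lambda>e. ls M (f e) (g e))"
  by (simp add: arith_pred_def pos_op_ls pos_op_nls)

lemma arith_pred_not: "arith_pred Q \<Longrightarrow> arith_pred (\<lambda>e. \<not> Q e)"
  by (simp add: arith_pred_def)

lemma arith_pred_conj: "arith_pred Q \<Longrightarrow> arith_pred R \<Longrightarrow> arith_pred (\<lambda>e. Q e \<and> R e)"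
  unfolding arith_pred_def de_Morgan_conj by (intro conjI pos_op_conj pos_op_disj) auto

lemma arith_pred_disj: "arith_pred Q \<Longrightarrow> arith_pred R \<Longrightarrow> arith_pred (\<lambda>e. Q e \<or> R e)"
  unfolding arith_pred_def de_Morgan_disj by (intro conjI pos_op_conj pos_op_disj) auto

lemma arith_pred_ex:
  "arith_pred (\<lambda>e. Q (e 0) (\<lambda>i. e (Suc i))) \<Longrightarrow> arith_pred (\<lambda>e. \<exists>x. Q x e)"
  using pos_op_ex[of "\<lambda>X. Q"] pos_op_all[of "\<lambda>X x e. \<not> Q x e"] by (simp add: arith_pred_def)

lemma arith_pred_finite_ex:
  assumes "finite C" and "\<And>c. c \<in> C \<Longrightarrow> arith_pred (Q c)"
  shows "arith_pred (\<lambda>e. \<exists>c\<in>C. Q c e)"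
  using assms by (induction C) (auto intro: arith_pred_const arith_pred_disj)

lemma arith_pred_subst:
  assumes "arith_pred Q" and "\<And>i. pos_term (F i)"
  shows "arith_pred (\<lambda>e. Q (\<lambda>i. F i e))"
  using assms pos_op_subst[of "\<lambda>X. Q" F] pos_op_subst[of "\<lambda>X e. \<not> Q e" F]
  by (simp add: arith_pred_def)

lemma arith_pred_app2:
  assumes "arith_pred (\<lambda>e. R (e 0) (e 1))" and "pos_term f" and "pos_term g"
  shows "arith_pred (\<lambda>e. R (f e) (g e))"
  using arith_pred_subst[of "\<lambda>e. R (e 0) (e 1)" "\<lambda>i. if i = 0 then f else g"] assms by simp

lemma arith_pred_app1: "arith_pred (\<lambda>e. R (e 0)) \<Longrightarrow> pos_term f \<Longrightarrow> arith_pred (\<lambda>e. R (f e))"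
  using arith_pred_subst[of "\<lambda>e. R (e 0)" "\<lambda>_. f"] by simp

lemmas pos_intros = pos_term_sc pos_term_ad pos_term_mu pos_term_var pos_term_zer
  arith_pred_not arith_pred_conj arith_pred_disj arith_pred_ex arith_pred_eq arith_pred_ls
  arith_pred_const pos_op_conj pos_op_disj pos_op_ex pos_op_all pos_op_X

lemma def_pred_pos_op:
  assumes "pos_op \<Phi>" and "def_pred (\<lambda>e. X (e 0))"
  shows "def_pred (\<Phi> X)"
proof -
  obtain A where "\<And>X e. sat M (\<lambda>_ :: unit. X) e A = \<Phi> X e"
    using assms(1) by (auto simp: pos_op_def)
  then show ?thesis using def_pred_sat[OF assms(2), of A] by simp
qed

lemma def_pred_arith: "arith_pred Q \<Longrightarrow> def_pred Q"
  using def_pred_pos_op[of "\<lambda>X. Q" "\<lambda>_. True", OF _ def_pred_const] by (simp add: arith_pred_def)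

lemma inductive_definition:
  assumes "pos_op (\<lambda>X e. \<Psi> X (e 0))"
  obtains \<phi> where "\<And>x. \<Psi> (P \<phi>) x \<Longrightarrow> P \<phi> x"
    and "\<And>Q x. def_pred (\<lambda>e. Q (e 0)) \<Longrightarrow> (\<And>x. \<Psi> Q x \<Longrightarrow> Q x) \<Longrightarrow> P \<phi> x \<Longrightarrow> Q x"
proof -
  obtain A where A: "pos_in_X A" "\<And>X e. sat M (\<lambda>_ :: unit. X) e A = \<Psi> X (e 0)"
    using assms by (auto simp: pos_op_def)
  \<comment> \<open>An operator form has no free variable besides 0. Since \<open>\<Psi>\<close>
    looks only at \<open>e 0\<close>, any others in \<open>A\<close> can be filled with
    \<open>Zero\<close>.\<close>
  define B where "B = subst (case_nat (Var 0) (\<lambda>_. Zero)) A"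
  have "fv B \<subseteq> {0}"
    using fv_subst[of "case_nat (Var 0) (\<lambda>_. Zero)" A] by (auto simp: B_def split: nat.splits)
  moreover have "pos_in_X B" using A(1) by (simp add: B_def)
  ultimately have B: "form_of (Opform B) = B" by (simp add: Opform_inverse)
  have sat: "sat M (\<lambda>_. X) (\<lambda>_. x) B = \<Psi> X x" for X x
    by (simp add: B_def sat_subst A)
  show thesis
  proof (rule that)
    show "P (Opform B) x" if "\<Psi> (P (Opform B)) x" for x
      using P_closed[of "Opform B" x] that by (simp add: B sat)
    show "Q x" if "def_pred (\<lambda>e. Q (e 0))" "\<And>x. \<Psi> Q x \<Longrightarrow> Q x" "P (Opform B) x" for Q x
      by (rule P_least[of Q "Opform B"]) (use that in \<open>simp_all add: B sat\<close>)
  qed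
qed

end

section \<open>Pairing\<close>

context id_model
begin

abbreviation Z :: 'a where "Z \<equiv> zer M"
abbreviation S :: "'a \<Rightarrow> 'a" where "S \<equiv> sc M"
abbreviation plus_M :: "'a \<Rightarrow> 'a \<Rightarrow> 'a" (infixl "\<oplus>" 65) where "x \<oplus> y \<equiv> ad M x y"
abbreviation times_M :: "'a \<Rightarrow> 'a \<Rightarrow> 'a" (infixl "\<otimes>" 70) where "x \<otimes> y \<equiv> mu M x y"

lemma S_neq_Z [simp]: "S x \<noteq> Z" "Z \<noteq> S x"
  using arith[of "Neq (Succ (Var 0)) Zero" "\<lambda>_. x"] by (auto simp: arith_axioms_def)

lemma S_inject [simp]: "S x = S y \<longleftrightarrow> x = y"
  using arith[of "Imp (Eq (Succ (Var 0)) (Succ (Var 1))) (Eq (Var 0) (Var 1))"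
      "case_nat x (\<lambda>_. y)"]
  by (auto simp: arith_axioms_def)

lemma add_Z [simp]: "x \<oplus> Z = x"
  using arith[of "Eq (Add (Var 0) Zero) (Var 0)" "\<lambda>_. x"] by (simp add: arith_axioms_def)

lemma add_S [simp]: "x \<oplus> S y = S (x \<oplus> y)"
  using arith[of "Eq (Add (Var 0) (Succ (Var 1))) (Succ (Add (Var 0) (Var 1)))"
      "case_nat x (\<lambda>_. y)"]
  by (simp add: arith_axioms_def)

lemma mul_Z [simp]: "x \<otimes> Z = Z"
  using arith[of "Eq (Mul (Var 0) Zero) Zero" "\<lambda>_. x"] by (simp add: arith_axioms_def)

lemma mul_S [simp]: "x \<otimes> S y = x \<otimes> y \<oplus> x"
  using arith[of "Eq (Mul (Var 0) (Succ (Var 1))) (Add (Mul (Var 0) (Var 1)) (Var 0))"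
      "case_nat x (\<lambda>_. y)"]
  by (simp add: arith_axioms_def)

lemma Z_add [simp]: "Z \<oplus> x = x"
  by (rule induct[where Q = "\<lambda>x. Z \<oplus> x = x"]) (intro def_intros | simp)+

lemma S_add [simp]: "S x \<oplus> y = S (x \<oplus> y)"
  by (rule induct[where Q = "\<lambda>y. S x \<oplus> y = S (x \<oplus> y)"]) (intro def_intros | simp)+

lemma add_assoc: "x \<oplus> y \<oplus> z = x \<oplus> (y \<oplus> z)"
  by (rule induct[where Q = "\<lambda>z. x \<oplus> y \<oplus> z = x \<oplus> (y \<oplus> z)"]) (intro def_intros | simp)+

lemma add_commute: "x \<oplus> y = y \<oplus> x"
  by (rule induct[where Q = "\<lambda>y. x \<oplus> y = y \<oplus> x"]) (intro def_intros | simp)+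

lemma add_left_commute: "x \<oplus> (y \<oplus> z) = y \<oplus> (x \<oplus> z)"
  by (metis add_assoc add_commute)

lemmas add_ac = add_assoc add_commute add_left_commute

lemma add_left_cancel [simp]: "x \<oplus> y = x \<oplus> z \<longleftrightarrow> y = z"
  by (rule induct[where Q = "\<lambda>x. x \<oplus> y = x \<oplus> z \<longrightarrow> y = z", THEN iffI[OF mp]])
    (intro def_intros | simp)+

lemma neq_S_add: "x \<noteq> S (x \<oplus> y)"
  by (rule induct[where Q = "\<lambda>x. x \<noteq> S (x \<oplus> y)"]) (intro def_intros | simp)+

lemma Z_or_S: "x = Z \<or> (\<exists>y. x = S y)"
  by (rule induct[where Q = "\<lambda>x. x = Z \<or> (\<exists>y. x = S y)"]) (intro def_intros | simp)+

lemma distrib_left: "x \<otimes> (y \<oplus> z) = x \<otimes> y \<oplus> x \<otimes> z"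
  by (rule induct[where Q = "\<lambda>z. x \<otimes> (y \<oplus> z) = x \<otimes> y \<oplus> x \<otimes> z"])
    (intro def_intros | simp add: add_assoc)+

lemma distrib_right: "(x \<oplus> y) \<otimes> z = x \<otimes> z \<oplus> y \<otimes> z"
  by (rule induct[where Q = "\<lambda>z. (x \<oplus> y) \<otimes> z = x \<otimes> z \<oplus> y \<otimes> z"])
    (intro def_intros | simp add: add_ac)+

lemma S_mul: "S x \<otimes> y = x \<otimes> y \<oplus> y"
  by (rule induct[where Q = "\<lambda>y. S x \<otimes> y = x \<otimes> y \<oplus> y"])
    (intro def_intros | simp add: add_ac)+

section \<open>Order defined from addition, and the least number principle\<close>

definition le :: "'a \<Rightarrow> 'a \<Rightarrow> bool" where
  "le x y \<longleftrightarrow> (\<exists>z. y = x \<oplus> z)"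

lemma def_pred_le: "def_term f \<Longrightarrow> def_term g \<Longrightarrow> def_pred (\<lambda>e. le (f e) (g e))"
  by (rule def_pred_app2) (unfold le_def, intro def_intros)

lemma le_trans: "le x y \<Longrightarrow> le y z \<Longrightarrow> le x z"
  unfolding le_def by (metis add_assoc)

lemma le_antisym: "le x y \<Longrightarrow> le y x \<Longrightarrow> x = y"
proof -
  assume "le x y" "le y x"
  then obtain u v where u: "y = x \<oplus> u" and "x = y \<oplus> v" by (auto simp: le_def)
  then have "x \<oplus> Z = x \<oplus> (u \<oplus> v)" by (metis add_Z add_assoc)
  then have "Z = u \<oplus> v" by (simp only: add_left_cancel)
  then show ?thesis using Z_or_S[of u] Z_or_S[of v] u by auto
qed

lemma le_or_S_le: "(\<exists>z. y = x \<oplus> z) \<or> (\<exists>z. x = S (y \<oplus> z))"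
proof (rule induct[where Q = "\<lambda>y. (\<exists>z. y = x \<oplus> z) \<or> (\<exists>z. x = S (y \<oplus> z))"])
  fix y assume "(\<exists>z. y = x \<oplus> z) \<or> (\<exists>z. x = S (y \<oplus> z))"
  then show "(\<exists>z. S y = x \<oplus> z) \<or> (\<exists>z. x = S (S y \<oplus> z))"
  proof
    assume "\<exists>z. y = x \<oplus> z"
    then show ?thesis by (metis add_S)
  next
    assume "\<exists>z. x = S (y \<oplus> z)"
    then obtain z where z: "x = S (y \<oplus> z)" by blast
    show ?thesis
      using Z_or_S[of z]
    proof
      assume "z = Z"
      then have "S y = x \<oplus> Z" using z by simp
      then show ?thesis by blast
    next
      assume "\<exists>w. z = S w"
      then show ?thesis using z by auto
    qed
  qed
next
  show "(\<exists>z. Z = x \<oplus> z) \<or> (\<exists>z. x = S (Z \<oplus> z))"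
    using Z_or_S[of x] by auto
qed (intro def_intros)

lemma le_total: "le x y \<or> le y x"
  using le_or_S_le[of y x] unfolding le_def by (metis add_S)

text \<open>Without a least element, every lower bound of \<open>Q\<close> could be raised by one,
  and by induction \<open>S x\<close> would be a lower bound, although \<open>Q x\<close>
  holds.\<close>

lemma least_exists:
  assumes "def_pred (\<lambda>e. Q (e 0))" and "Q x"
  shows "\<exists>y. Q y \<and> (\<forall>z. Q z \<longrightarrow> le y z)"
proof (rule ccontr)
  assume no: "\<not> ?thesis"
  have "\<forall>z. Q z \<longrightarrow> le y z" for y
  proof (rule induct[where Q = "\<lambda>y. \<forall>z. Q z \<longrightarrow> le y z"])
    show "def_pred (\<lambda>e. \<forall>z. Q z \<longrightarrow> le (e 0) z)"
      by (intro def_intros def_pred_le def_pred_app1[OF assms(1)])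
    show "\<forall>z. Q z \<longrightarrow> le Z z" by (auto simp: le_def)
    fix y assume *: "\<forall>z. Q z \<longrightarrow> le y z"
    show "\<forall>z. Q z \<longrightarrow> le (S y) z"
    proof (intro allI impI)
      fix z assume "Q z"
      then obtain w where w: "z = y \<oplus> w" using * by (auto simp: le_def)
      have "w \<noteq> Z" using no * \<open>Q z\<close> w by auto
      then show "le (S y) z" using w Z_or_S[of w] by (auto simp: le_def)
    qed
  qed
  then have "le (S x) x" using assms(2) by blast
  then show False using neq_S_add by (auto simp: le_def)
qed

text \<open>
  As \<open>pr a b\<close> is never \<open>Z\<close>, iterated pairs also serve as lists, with \<open>Z\<close> as the empty list.
\<close>

definition pr :: "'a \<Rightarrow> 'a \<Rightarrow> 'a" where
  "pr a b = S ((a \<oplus> b) \<otimes> (a \<oplus> b) \<oplus> a)"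

lemma def_term_pr: "def_term f \<Longrightarrow> def_term g \<Longrightarrow> def_term (\<lambda>e. pr (f e) (g e))"
  unfolding pr_def by (intro def_intros)

lemma pos_term_pr: "pos_term f \<Longrightarrow> pos_term g \<Longrightarrow> pos_term (\<lambda>e. pr (f e) (g e))"
  unfolding pr_def by (intro pos_intros)

lemma pr_neq_Z [simp]: "pr a b \<noteq> Z" "Z \<noteq> pr a b"
  by (simp_all add: pr_def)

text \<open>With \<open>n = a \<oplus> b\<close>, the code before its successor lies between
  \<open>n \<otimes> n\<close> and \<open>n \<otimes> n \<oplus> n\<close>, hence below the square
  of any larger sum. In the calculation \<open>w\<close> collects what remains of that square after
  \<open>S n \<otimes> S n\<close>.\<close>

lemma pr_neq_of_less:
  assumes "c \<oplus> d = S (a \<oplus> b \<oplus> r)"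
  shows "pr a b \<noteq> pr c d"
proof
  define n where "n = a \<oplus> b"
  define w where "w = S n \<otimes> r \<oplus> (r \<otimes> S n \<oplus> r \<otimes> r)"
  have "(S n \<oplus> r) \<otimes> (S n \<oplus> r) = S n \<otimes> S n \<oplus> w"
    by (simp only: distrib_left distrib_right w_def add_ac)
  also have "S n \<otimes> S n = n \<otimes> n \<oplus> S (n \<oplus> n)"
    by (simp add: S_mul add_ac)
  finally have sq: "(S n \<oplus> r) \<otimes> (S n \<oplus> r) = n \<otimes> n \<oplus> S (n \<oplus> n) \<oplus> w" .
  assume "pr a b = pr c d"
  then have "n \<otimes> n \<oplus> a = (S n \<oplus> r) \<otimes> (S n \<oplus> r) \<oplus> c"
    using assms by (simp add: pr_def n_def)
  then have "n \<otimes> n \<oplus> a = n \<otimes> n \<oplus> (S (n \<oplus> n) \<oplus> w \<oplus> c)"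
    by (simp only: sq add_assoc)
  then have "a = S (n \<oplus> n) \<oplus> w \<oplus> c" by (simp only: add_left_cancel)
  then have "a = S (a \<oplus> (b \<oplus> n \<oplus> w \<oplus> c))" by (simp add: n_def add_ac)
  then show False using neq_S_add by blast
qed

lemma pr_inject [simp]: "pr a b = pr c d \<longleftrightarrow> a = c \<and> b = d"
proof
  assume eq: "pr a b = pr c d"
  have "\<not> (\<exists>r. c \<oplus> d = S (a \<oplus> b \<oplus> r))" "\<not> (\<exists>r. a \<oplus> b = S (c \<oplus> d \<oplus> r))"
    using pr_neq_of_less eq by metis+
  then obtain r where r: "c \<oplus> d = a \<oplus> b \<oplus> r"
    using le_or_S_le[where y = "c \<oplus> d" and x = "a \<oplus> b"] by blast
  then have "r = Z"
    using Z_or_S[of r] \<open>\<not> (\<exists>r. c \<oplus> d = S (a \<oplus> b \<oplus> r))\<close> by auto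
  then have sum: "c \<oplus> d = a \<oplus> b" using r by simp
  then have "a = c" using eq by (simp add: pr_def)
  with sum show "a = c \<and> b = d" by simp
qed simp

text \<open>Compare \<open>k\<close>, \<open>x \<oplus> k\<close>, the square of the latter, and the
  code. This is the source of fairness: stage \<open>pr (pr m r) j\<close> does not precede stage
  \<open>j\<close>.\<close>

lemma le_pr: "le k (pr x k)"
proof -
  let ?n = "x \<oplus> k"
  have "le ?n (?n \<otimes> ?n)"
    using Z_or_S[of ?n]
  proof
    assume "\<exists>p. ?n = S p"
    then obtain p where "?n = S p" by blast
    then show ?thesis unfolding le_def by (metis mul_S add_commute)
  qed (auto simp: le_def)
  moreover have "le k ?n" unfolding le_def by (metis add_commute)
  moreover have "le (?n \<otimes> ?n) (pr x k)" unfolding le_def pr_def by (metis add_S)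
  ultimately show ?thesis using le_trans by blast
qed

end

section \<open>Inductive refutability of finite sets of obligations\<close>

text \<open>
  An obligation \<open>m\<close> entails all \<open>r\<close> with \<open>All m r\<close> and, if it is disjunctive (\<open>Dis m\<close>), at least one
  \<open>r\<close> with \<open>Any m r\<close>; \<open>Con\<close> relates conflicting obligations.
\<close>

locale obligations = id_model M P nm
  for M :: "'a arith" and P :: "opform \<Rightarrow> 'a \<Rightarrow> bool" and nm :: "nat \<Rightarrow> 'a" +
  fixes Con All Any :: "'a \<Rightarrow> 'a \<Rightarrow> bool" and Dis :: "'a \<Rightarrow> bool"
  assumes arith_Con: "arith_pred (\<lambda>e. Con (e 0) (e 1))"
    and arith_All: "arith_pred (\<lambda>e. All (e 0) (e 1))"
    and arith_Any: "arith_pred (\<lambda>e. Any (e 0) (e 1))"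
    and arith_Dis: "arith_pred (\<lambda>e. Dis (e 0))"
    and All_not_Dis: "All m r \<Longrightarrow> \<not> Dis m"
begin

text \<open>
  One operator defines list membership (tag \<open>Z\<close>) and refutability of lists (tag \<open>S Z\<close>)
  simultaneously, because the former is not available inside operator forms.
\<close>

definition refute_op :: "('a \<Rightarrow> bool) \<Rightarrow> 'a \<Rightarrow> bool" where
  "refute_op X x \<longleftrightarrow>
    (\<exists>m s. x = pr Z (pr m (pr m s))) \<or>
    (\<exists>m a s. x = pr Z (pr m (pr a s)) \<and> X (pr Z (pr m s))) \<or>
    (\<exists>s. x = pr (S Z) s \<and>
      ((\<exists>m m'. X (pr Z (pr m s)) \<and> X (pr Z (pr m' s)) \<and> Con m m') \<or>
       (\<exists>m r. X (pr Z (pr m s)) \<and> All m r \<and> X (pr (S Z) (pr r s))) \<or>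
       (\<exists>m. X (pr Z (pr m s)) \<and> Dis m \<and> (\<forall>r. \<not> Any m r \<or> X (pr (S Z) (pr r s))))))"

text \<open>The premise of the disjunctive rule is an implication from \<open>Any\<close>; written
  as a disjunction it is positive in \<open>X\<close>, because its negated part is
  arithmetical.\<close>

lemma pos_op_refute: "pos_op (\<lambda>X e. refute_op X (e 0))"
  unfolding refute_op_def
  by (intro pos_op_disj pos_op_conj pos_op_ex pos_op_all pos_op_X pos_term_pr pos_term_var
      pos_term_sc pos_term_zer pos_op_eq arith_pred_pos arith_pred_not
      arith_pred_app2[OF arith_Con] arith_pred_app2[OF arith_All] arith_pred_app2[OF arith_Any]
      arith_pred_app1[OF arith_Dis])

lemma refute_op_mono: "refute_op X x \<Longrightarrow> (\<And>y. X y \<Longrightarrow> X' y) \<Longrightarrow> refute_op X' x"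
  unfolding refute_op_def by blast

lemma refute_exists:
  "\<exists>\<phi>. (\<forall>x. refute_op (P \<phi>) x \<longrightarrow> P \<phi> x) \<and>
    (\<forall>Q x. def_pred (\<lambda>e. Q (e 0)) \<longrightarrow> (\<forall>x. refute_op Q x \<longrightarrow> Q x) \<longrightarrow> P \<phi> x \<longrightarrow> Q x)"
  by (rule inductive_definition[OF pos_op_refute]) blast

definition refute_form :: opform where
  "refute_form = (SOME \<phi>. (\<forall>x. refute_op (P \<phi>) x \<longrightarrow> P \<phi> x) \<and>
    (\<forall>Q x. def_pred (\<lambda>e. Q (e 0)) \<longrightarrow> (\<forall>x. refute_op Q x \<longrightarrow> Q x) \<longrightarrow> P \<phi> x \<longrightarrow> Q x))"

lemma refute_closed: "refute_op (P refute_form) x \<Longrightarrow> P refute_form x"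
  using someI_ex[OF refute_exists] unfolding refute_form_def by blast

lemma refute_least:
  "def_pred (\<lambda>e. Q (e 0)) \<Longrightarrow> (\<And>x. refute_op Q x \<Longrightarrow> Q x) \<Longrightarrow> P refute_form x \<Longrightarrow> Q x"
  using someI_ex[OF refute_exists] unfolding refute_form_def by blast

text \<open>Knaster-Tarski: by monotonicity \<open>refute_op (P refute_form)\<close> is itself
  closed, and a positive operator applied to a definable predicate is definable, so leastness
  applies to it.\<close>

lemma refute_fixpoint: "P refute_form x \<longleftrightarrow> refute_op (P refute_form) x"
proof
  assume "P refute_form x"
  then show "refute_op (P refute_form) x"
  proof (rule refute_least[rotated 2])
    show "def_pred (\<lambda>e. refute_op (P refute_form) (e 0))"
      by (rule def_pred_pos_op[OF pos_op_refute]) (intro def_intros)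
    show "refute_op (P refute_form) x" if "refute_op (refute_op (P refute_form)) x" for x
      using that refute_closed by (rule refute_op_mono)
  qed
qed (rule refute_closed)

text \<open>A list may have nonstandard length, so membership comes from the inductive predicate and
  not from a recursion in HOL.\<close>

definition mem :: "'a \<Rightarrow> 'a \<Rightarrow> bool" where
  "mem m s \<longleftrightarrow> P refute_form (pr Z (pr m s))"

definition refutable :: "'a \<Rightarrow> bool" where
  "refutable s \<longleftrightarrow> P refute_form (pr (S Z) s)"

lemma mem_Z [simp]: "\<not> mem m Z"
  unfolding mem_def by (subst refute_fixpoint) (simp add: refute_op_def)

lemma mem_pr [simp]: "mem m (pr a s) \<longleftrightarrow> m = a \<or> mem m s"
  unfolding mem_def by (subst refute_fixpoint) (auto simp: refute_op_def)

lemma refutable_iff: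
  "refutable s \<longleftrightarrow>
    (\<exists>m m'. mem m s \<and> mem m' s \<and> Con m m') \<or>
    (\<exists>m r. mem m s \<and> All m r \<and> refutable (pr r s)) \<or>
    (\<exists>m. mem m s \<and> Dis m \<and> (\<forall>r. \<not> Any m r \<or> refutable (pr r s)))"
  unfolding refutable_def mem_def by (subst refute_fixpoint) (simp add: refute_op_def)

lemma def_pred_mem: "def_term f \<Longrightarrow> def_term g \<Longrightarrow> def_pred (\<lambda>e. mem (f e) (g e))"
  unfolding mem_def by (intro def_intros def_term_pr)

lemma def_pred_refutable: "def_term f \<Longrightarrow> def_pred (\<lambda>e. refutable (f e))"
  unfolding refutable_def by (intro def_intros def_term_pr)

lemma refutable_induct:
  assumes "refutable s" and "def_pred (\<lambda>e. Q (e 0))"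
    and Con: "\<And>s m m'. mem m s \<Longrightarrow> mem m' s \<Longrightarrow> Con m m' \<Longrightarrow> Q s"
    and All: "\<And>s m r. mem m s \<Longrightarrow> All m r \<Longrightarrow> Q (pr r s) \<Longrightarrow> Q s"
    and Any: "\<And>s m. mem m s \<Longrightarrow> Dis m \<Longrightarrow> (\<And>r. Any m r \<Longrightarrow> Q (pr r s)) \<Longrightarrow> Q s"
  shows "Q s"
proof -
  \<comment> \<open>The predicate must cover both tags of the simultaneous definition; on membership
    it is kept exact, so that the closure conditions yield genuine \<open>mem\<close> facts.\<close>
  define R where "R x \<longleftrightarrow>
    (\<exists>m s. x = pr Z (pr m s) \<and> mem m s) \<or> (\<exists>s. x = pr (S Z) s \<and> Q s)" for x
  have R_simps: "R (pr Z (pr m s)) \<longleftrightarrow> mem m s" "R (pr (S Z) s) \<longleftrightarrow> Q s" for m s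
    by (auto simp: R_def)
  have "R (pr (S Z) s)"
  proof (rule refute_least)
    show "def_pred (\<lambda>e. R (e 0))"
      unfolding R_def by (intro def_intros def_term_pr def_pred_mem def_pred_app1[OF assms(2)])
    show "R x" if "refute_op R x" for x
      using that unfolding refute_op_def
      by (elim disjE exE conjE) (auto simp: R_simps intro: Con All Any)
    show "P refute_form (pr (S Z) s)" using assms(1) by (simp add: refutable_def)
  qed
  then show ?thesis by (simp add: R_simps)
qed

text \<open>Approximations to the recursively defined function are lists of argument-value pairs.\<close>

lemma recursion:
  assumes G: "def_pred (\<lambda>e. G (e 0) (e 1) (e 2))" and G1: "\<And>k v. \<exists>!w. G k v w"
  obtains F where "def_pred (\<lambda>e. F (e 0) = e 1)" and "F Z = a" and "\<And>k. G k (F k) (F (S k))"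
proof -
  \<comment> \<open>A list need not be ordered or functional: each entry is only traced back to its
    predecessor. Single-valuedness is recovered by induction on the argument, and a good list can be
    prolonged without rechecking old entries.\<close>
  define good where "good l \<longleftrightarrow> (\<forall>k v. mem (pr k v) l \<longrightarrow>
    (k = Z \<and> v = a) \<or> (\<exists>k' v'. k = S k' \<and> mem (pr k' v') l \<and> G k' v' v))" for l
  define graph where "graph k v \<longleftrightarrow> (\<exists>l. good l \<and> mem (pr k v) l)" for k v
  have def_graph: "def_pred (\<lambda>e. graph (e 0) (e 1))"
    unfolding graph_def good_def
    by (intro def_intros def_term_pr def_pred_mem def_pred_app3[OF G])
  have graph_Z: "graph Z v \<longleftrightarrow> v = a" for v
  proof
    assume "v = a"
    then have "good (pr (pr Z v) Z) \<and> mem (pr Z v) (pr (pr Z v) Z)" by (simp add: good_def)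
    then show "graph Z v" unfolding graph_def by blast
  next
    assume "graph Z v"
    then show "v = a" unfolding graph_def good_def using S_neq_Z by metis
  qed
  have graph_S: "graph (S k) v \<longleftrightarrow> (\<exists>u. graph k u \<and> G k u v)" for k v
  proof
    assume "graph (S k) v"
    then obtain l where l: "good l" "mem (pr (S k) v) l" by (auto simp: graph_def)
    then have "(S k = Z \<and> v = a) \<or> (\<exists>k' v'. S k = S k' \<and> mem (pr k' v') l \<and> G k' v' v)"
      unfolding good_def by blast
    then show "\<exists>u. graph k u \<and> G k u v" using l(1) by (auto simp: graph_def)
  next
    assume "\<exists>u. graph k u \<and> G k u v"
    then obtain u l where l: "good l" "mem (pr k u) l" "G k u v" by (auto simp: graph_def)
    have "good (pr (pr (S k) v) l)"
      using l unfolding good_def by (simp, metis)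
    then show "graph (S k) v" unfolding graph_def by (intro exI[of _ "pr (pr (S k) v) l"]) simp
  qed
  have ex: "\<exists>v. graph k v" for k
  proof (rule induct[where Q = "\<lambda>k. \<exists>v. graph k v"])
    show "def_pred (\<lambda>e. \<exists>v. graph (e 0) v)"
      by (intro def_intros def_pred_app2[OF def_graph])
    show "\<exists>v. graph Z v" by (simp add: graph_Z)
    show "\<exists>v. graph (S k) v" if "\<exists>v. graph k v" for k
      using that G1 unfolding graph_S by blast
  qed
  have uniq: "\<forall>v w. graph k v \<longrightarrow> graph k w \<longrightarrow> v = w" for k
  proof (rule induct[where Q = "\<lambda>k. \<forall>v w. graph k v \<longrightarrow> graph k w \<longrightarrow> v = w"])
    show "def_pred (\<lambda>e. \<forall>v w. graph (e 0) v \<longrightarrow> graph (e 0) w \<longrightarrow> v = w)"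
      by (intro def_intros def_pred_app2[OF def_graph])
    show "\<forall>v w. graph Z v \<longrightarrow> graph Z w \<longrightarrow> v = w" by (simp add: graph_Z)
    show "\<forall>v w. graph (S k) v \<longrightarrow> graph (S k) w \<longrightarrow> v = w"
      if "\<forall>v w. graph k v \<longrightarrow> graph k w \<longrightarrow> v = w" for k
      using that G1 unfolding graph_S by metis
  qed
  define F where "F k = (THE v. graph k v)" for k
  have F: "F k = v \<longleftrightarrow> graph k v" for k v
    unfolding F_def using ex[of k] uniq[of k] by (metis the_equality)
  show thesis
  proof (rule that)
    show "def_pred (\<lambda>e. F (e 0) = e 1)" using def_graph by (simp add: F)
    show "F Z = a" by (simp add: F graph_Z)
    show "G k (F k) (F (S k))" for k
      using graph_S[of k "F (S k)"] F by metis
  qed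
qed

section \<open>Hintikka sets and irrefutability\<close>

definition hintikka :: "'a set \<Rightarrow> bool" where
  "hintikka W \<longleftrightarrow> (\<forall>m\<in>W. (\<forall>m'\<in>W. \<not> Con m m') \<and> (\<forall>r. All m r \<longrightarrow> r \<in> W) \<and>
    (Dis m \<longrightarrow> (\<exists>r\<in>W. Any m r)))"

text \<open>Induction on refutability shows that some entry of the list lies outside
  \<open>W\<close>. In the disjunctive case the premise used is the one for the alternative that
  \<open>W\<close> contains. Definability of \<open>W\<close> admits this induction.\<close>

lemma not_refutable_if_hintikka:
  assumes "hintikka W" and "def_pred (\<lambda>e. e 0 \<in> W)" and "m \<in> W"
  shows "\<not> refutable (pr m Z)"
proof
  assume "refutable (pr m Z)"
  then have "\<exists>m'. mem m' (pr m Z) \<and> m' \<notin> W"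
  proof (rule refutable_induct[where Q = "\<lambda>s. \<exists>m. mem m s \<and> m \<notin> W"])
    show "def_pred (\<lambda>e. \<exists>m. mem m (e 0) \<and> m \<notin> W)"
      by (intro def_intros def_pred_mem def_pred_app1[OF assms(2)])
    show "\<exists>m. mem m s \<and> m \<notin> W" if "mem m s" "mem m' s" "Con m m'" for s m m'
      using that assms(1) unfolding hintikka_def by blast
    show "\<exists>m. mem m s \<and> m \<notin> W" if "mem m s" "All m r" "\<exists>m'. mem m' (pr r s) \<and> m' \<notin> W" for s m r
      using that assms(1) unfolding hintikka_def by auto
    show "\<exists>m. mem m s \<and> m \<notin> W"
      if "mem m s" "Dis m" "\<And>r. Any m r \<Longrightarrow> \<exists>m'. mem m' (pr r s) \<and> m' \<notin> W" for s m
      using that assms(1) unfolding hintikka_def by (metis mem_pr)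
  qed
  then show False using assms(3) by simp
qed

text \<open>
  Stage \<open>pr (pr m r) j\<close> of the construction takes care of the obligation \<open>r\<close> of \<open>m\<close>; the
  additional \<open>j\<close> makes every such pair come up arbitrarily late.
\<close>

lemma hintikka_if_not_refutable:
  assumes m0: "\<not> refutable (pr m0 Z)"
  obtains W where "hintikka W" and "def_pred (\<lambda>e. e 0 \<in> W)" and "m0 \<in> W"
proof -
  \<comment> \<open>The component \<open>r\<close> of the stage number selects a conjunctive
    consequence; at a disjunctive \<open>m\<close> it is ignored and any alternative
    \<open>r'\<close> may be added.\<close>
  define ok where "ok k s t \<longleftrightarrow> \<not> refutable t \<and> (\<exists>m r j. k = pr (pr m r) j \<and> mem m s \<and>
    (All m r \<and> t = pr r s \<or> Dis m \<and> (\<exists>r'. Any m r' \<and> t = pr r' s)))" for k s t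
  \<comment> \<open>Taking the least admissible list is a definable choice; a stage with nothing to
    do repeats the list.\<close>
  define G where "G k s t \<longleftrightarrow> (ok k s t \<and> (\<forall>u. ok k s u \<longrightarrow> le t u)) \<or> ((\<forall>u. \<not> ok k s u) \<and> t = s)"
    for k s t
  note def_rules = def_intros def_term_pr def_pred_mem def_pred_refutable def_pred_le
    def_pred_app2[OF def_pred_arith[OF arith_All]] def_pred_app2[OF def_pred_arith[OF arith_Any]]
    def_pred_app1[OF def_pred_arith[OF arith_Dis]]
  have def_ok: "def_pred (\<lambda>e. ok (e 0) (e 1) (e 2))"
    unfolding ok_def by (intro def_rules)
  have def_G: "def_pred (\<lambda>e. G (e 0) (e 1) (e 2))"
    unfolding G_def by (intro def_rules def_pred_app3[OF def_ok])
  have "\<exists>!t. G k s t" for k s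
  proof (cases "\<exists>u. ok k s u")
    case True
    then obtain t where t: "ok k s t" "\<And>u. ok k s u \<Longrightarrow> le t u"
      using least_exists[of "ok k s"] def_pred_app3[OF def_ok def_term_const def_term_const def_term_var]
      by blast
    then show ?thesis unfolding G_def by (metis le_antisym)
  qed (auto simp: G_def)
  then obtain F where def_F: "def_pred (\<lambda>e. F (e 0) = e 1)" and F_Z: "F Z = pr m0 Z"
    and F_S: "\<And>k. G k (F k) (F (S k))"
    using recursion[OF def_G, of "pr m0 Z"] by blast
  \<comment> \<open>\<open>F\<close> is available only through its definable graph, so its value has
    to be named by a quantified \<open>s\<close>.\<close>
  have "def_pred (\<lambda>e. \<exists>s. F (e 1) = s \<and> mem (e 0) s)"
    by (intro def_rules def_pred_app2[OF def_F])
  then have "def_pred (\<lambda>e. mem (e 0) (F (e 1)))" by simp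
  note def_mem_F = def_pred_app2[where R = "\<lambda>m k. mem m (F k)", OF this]
  have F_step: "F (S k) = F k \<or> (\<exists>r. F (S k) = pr r (F k))" for k
    using F_S[of k] unfolding G_def ok_def by blast
  have not_ref: "\<not> refutable (F k)" for k
  proof (rule induct[where Q = "\<lambda>k. \<not> refutable (F k)"])
    have "def_pred (\<lambda>e. \<forall>s. F (e 0) = s \<longrightarrow> \<not> refutable s)"
      by (intro def_rules def_pred_app2[OF def_F])
    then show "def_pred (\<lambda>e. \<not> refutable (F (e 0)))" by simp
    show "\<not> refutable (F Z)" using m0 by (simp add: F_Z)
    show "\<not> refutable (F (S k))" if "\<not> refutable (F k)" for k
      using F_S[of k] that unfolding G_def ok_def by auto
  qed
  have mem_add: "mem m (F k) \<longrightarrow> mem m (F (k \<oplus> j))" for m k j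
  proof (rule induct[where Q = "\<lambda>j. mem m (F k) \<longrightarrow> mem m (F (k \<oplus> j))"])
    show "def_pred (\<lambda>e. mem m (F k) \<longrightarrow> mem m (F (k \<oplus> e 0)))"
      by (intro def_rules def_mem_F)
    show "mem m (F k) \<longrightarrow> mem m (F (k \<oplus> S j))" if "mem m (F k) \<longrightarrow> mem m (F (k \<oplus> j))" for j
      using F_step[of "k \<oplus> j"] that by auto
  qed simp
  have mem_mono: "mem m (F k) \<Longrightarrow> le k k' \<Longrightarrow> mem m (F k')" for m k k'
    using mem_add by (auto simp: le_def)
  define W where "W = {m. \<exists>k. mem m (F k)}"
  show thesis
  proof (rule that)
    show "def_pred (\<lambda>e. e 0 \<in> W)"
      unfolding W_def mem_Collect_eq by (intro def_rules def_mem_F)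
    show "m0 \<in> W" using F_Z unfolding W_def by (auto intro: exI[of _ Z])
    show "hintikka W"
      unfolding hintikka_def
    proof (intro ballI conjI allI impI)
      fix m m' assume "m \<in> W" "m' \<in> W"
      then obtain k k' where k: "mem m (F k)" "mem m' (F k')" by (auto simp: W_def)
      then have "\<exists>l. mem m (F l) \<and> mem m' (F l)"
        using mem_mono le_total by blast
      then show "\<not> Con m m'" using not_ref refutable_iff by blast
    next
      fix m r assume "m \<in> W" and All: "All m r"
      then obtain j where "mem m (F j)" by (auto simp: W_def)
      \<comment> \<open>The stage \<open>j\<close> at which \<open>m\<close> is already present is
        put into the number, so that by \<open>le_pr\<close> the obligation is treated after
        \<open>m\<close> has entered.\<close>
      define k where "k = pr (pr m r) j"
      have mem: "mem m (F k)" using mem_mono[OF \<open>mem m (F j)\<close>] le_pr by (simp add: k_def)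
      have "\<not> refutable (pr r (F k))"
        using not_ref[of k] refutable_iff[of "F k"] mem All by blast
      then have "ok k (F k) (pr r (F k))"
        using mem All unfolding ok_def k_def by blast
      then have "ok k (F k) (F (S k))" using F_S[of k] unfolding G_def by blast
      \<comment> \<open>The stage number determines \<open>m\<close> and \<open>r\<close>, and
        \<open>All_not_Dis\<close> excludes the disjunctive alternative of \<open>ok\<close>; the
        list chosen is thus the intended one.\<close>
      then have "F (S k) = pr r (F k)"
        using All_not_Dis[OF All] by (auto simp: ok_def k_def)
      then have "mem r (F (S k))" by simp
      then show "r \<in> W" by (auto simp: W_def)
    next
      fix m assume "m \<in> W" and Dis: "Dis m"
      then obtain j where "mem m (F j)" by (auto simp: W_def)
      \<comment> \<open>\<open>Z\<close> is an arbitrary filler: a disjunctive obligation prescribes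
        no particular \<open>r\<close>.\<close>
      define k where "k = pr (pr m Z) j"
      have mem: "mem m (F k)" using mem_mono[OF \<open>mem m (F j)\<close>] le_pr by (simp add: k_def)
      obtain r where "Any m r" "\<not> refutable (pr r (F k))"
        using not_ref[of k] refutable_iff[of "F k"] mem Dis by blast
      then have "ok k (F k) (pr r (F k))"
        using mem Dis unfolding ok_def k_def by blast
      then have "ok k (F k) (F (S k))" using F_S[of k] unfolding G_def by blast
      then obtain r' where "Any m r'" "F (S k) = pr r' (F k)"
        using All_not_Dis[of m Z] Dis by (auto simp: ok_def k_def)
      then have "Any m r'" "mem r' (F (S k))" by simp_all
      then show "\<exists>r\<in>W. Any m r" by (auto simp: W_def)
    qed
  qed
qed

end

section \<open>Hintikka sets of second order formulas\<close>

text \<open>Free variables are not instantiated, so the set stays finite; instances arise by pairing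
  with an environment. Set quantifiers are treated as atoms because only arithmetical formulas are
  decomposed.\<close>

primrec sub :: "fm2 \<Rightarrow> fm2 set" where
  "sub (Eq2 s t) = {Eq2 s t}"
| "sub (Neq2 s t) = {Neq2 s t}"
| "sub (Less2 s t) = {Less2 s t}"
| "sub (NLess2 s t) = {NLess2 s t}"
| "sub (Mem t X) = {Mem t X}"
| "sub (NMem t X) = {NMem t X}"
| "sub (Conj2 A B) = insert (Conj2 A B) (sub A \<union> sub B)"
| "sub (Disj2 A B) = insert (Disj2 A B) (sub A \<union> sub B)"
| "sub (Forall2 A) = insert (Forall2 A) (sub A)"
| "sub (Exists2 A) = insert (Exists2 A) (sub A)"
| "sub (ForallS A) = {ForallS A}"
| "sub (ExistsS A) = {ExistsS A}"

lemma finite_sub: "finite (sub A)"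
  by (induction A) auto

lemma sub_refl: "A \<in> sub A"
  by (cases A) auto

lemma sub_Conj2: "Conj2 A B \<in> sub C \<Longrightarrow> A \<in> sub C \<and> B \<in> sub C"
  by (induction C) (auto simp: sub_refl)

lemma sub_Disj2: "Disj2 A B \<in> sub C \<Longrightarrow> A \<in> sub C \<and> B \<in> sub C"
  by (induction C) (auto simp: sub_refl)

lemma sub_Forall2: "Forall2 A \<in> sub C \<Longrightarrow> A \<in> sub C"
  by (induction C) (auto simp: sub_refl)

lemma sub_Exists2: "Exists2 A \<in> sub C \<Longrightarrow> A \<in> sub C"
  by (induction C) (auto simp: sub_refl)

lemma arithmetical_sub: "arithmetical C \<Longrightarrow> A \<in> sub C \<Longrightarrow> arithmetical A \<and> fvs2 A \<subseteq> fvs2 C"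
  by (induction C) auto

lemma arithmetical_neg2 [simp]: "arithmetical (neg2 A) = arithmetical A"
  by (induction A) auto

lemma fvs2_neg2 [simp]: "fvs2 (neg2 A) = fvs2 A"
  by (induction A) auto

lemma finite_fvn2 [simp]: "finite (fvn2 A)"
  by (induction A) (auto intro: finite_Suc_preimage)

lemma sat2_cong:
  "arithmetical A \<Longrightarrow> (\<And>i. i \<in> fvn2 A \<Longrightarrow> e i = e' i) \<Longrightarrow> sat2 M \<S> e V A \<longleftrightarrow> sat2 M \<S> e' V A"
proof (induction A arbitrary: e e')
  case (Forall2 A)
  have "sat2 M \<S> (case_nat x e) V A \<longleftrightarrow> sat2 M \<S> (case_nat x e') V A" for x
    by (rule Forall2.IH) (use Forall2.prems in \<open>auto split: nat.split\<close>)
  then show ?case by simp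
next
  case (Exists2 A)
  have "sat2 M \<S> (case_nat x e) V A \<longleftrightarrow> sat2 M \<S> (case_nat x e') V A" for x
    by (rule Exists2.IH) (use Exists2.prems in \<open>auto split: nat.split\<close>)
  then show ?case by simp
next
  case (Conj2 A B)
  have "sat2 M \<S> e V A \<longleftrightarrow> sat2 M \<S> e' V A" "sat2 M \<S> e V B \<longleftrightarrow> sat2 M \<S> e' V B"
    by (rule Conj2.IH; use Conj2.prems in simp)+
  then show ?case by simp
next
  case (Disj2 A B)
  have "sat2 M \<S> e V A \<longleftrightarrow> sat2 M \<S> e' V A" "sat2 M \<S> e V B \<longleftrightarrow> sat2 M \<S> e' V B"
    by (rule Disj2.IH; use Disj2.prems in simp)+
  then show ?case by simp
next
  case (Eq2 s t)
  have "eval M e s = eval M e' s" "eval M e t = eval M e' t"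
    by (rule eval_cong; use Eq2.prems in simp)+
  then show ?case by simp
next
  case (Neq2 s t)
  have "eval M e s = eval M e' s" "eval M e t = eval M e' t"
    by (rule eval_cong; use Neq2.prems in simp)+
  then show ?case by simp
next
  case (Less2 s t)
  have "eval M e s = eval M e' s" "eval M e t = eval M e' t"
    by (rule eval_cong; use Less2.prems in simp)+
  then show ?case by simp
next
  case (NLess2 s t)
  have "eval M e s = eval M e' s" "eval M e t = eval M e' t"
    by (rule eval_cong; use NLess2.prems in simp)+
  then show ?case by simp
next
  case (Mem t X)
  have "eval M e t = eval M e' t"
    by (rule eval_cong) (use Mem.prems in simp)
  then show ?case by simp
next
  case (NMem t X)
  have "eval M e t = eval M e' t"
    by (rule eval_cong) (use NMem.prems in simp)
  then show ?case by simp
qed simp_all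

section \<open>Coding of formula instances and environments\<close>

context id_model
begin

definition num :: "nat \<Rightarrow> 'a" where
  "num n = (S ^^ n) Z"

lemma num_inject [simp]: "num m = num n \<longleftrightarrow> m = n"
proof (induction m arbitrary: n)
  case 0
  then show ?case by (cases n) (simp_all add: num_def)
next
  case (Suc m)
  then show ?case by (cases n) (simp_all add: num_def)
qed

lemma pos_term_num: "pos_term (\<lambda>e. num n)"
  by (induction n) (simp_all add: num_def pos_intros)

text \<open>The tag is a standard numeral, hence a closed term that operator forms can use; only the
  environment \<open>x\<close> ranges over the model.\<close>

definition ob :: "fm2 \<Rightarrow> 'a \<Rightarrow> 'a" where
  "ob A x = pr (num (to_nat A)) x"

lemma ob_inject [simp]: "ob A x = ob B y \<longleftrightarrow> A = B \<and> x = y"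
  by (simp add: ob_def)

lemma pos_term_ob: "pos_term f \<Longrightarrow> pos_term (\<lambda>e. ob A (f e))"
  unfolding ob_def by (intro pos_term_pr pos_term_num)

lemma def_term_ob: "def_term f \<Longrightarrow> def_term (\<lambda>e. ob A (f e))"
  unfolding ob_def by (intro def_intros def_term_pr)

definition is_pr :: "'a \<Rightarrow> bool" where
  "is_pr x \<longleftrightarrow> (\<exists>a b. x = pr a b)"

text \<open>The default \<open>Z\<close> off the pairs makes the projection total while its graph
  stays arithmetical.\<close>

definition pr1 :: "'a \<Rightarrow> 'a" where
  "pr1 x = (THE a. (\<exists>b. x = pr a b) \<or> \<not> is_pr x \<and> a = Z)"

definition pr2 :: "'a \<Rightarrow> 'a" where
  "pr2 x = (THE b. (\<exists>a. x = pr a b) \<or> \<not> is_pr x \<and> b = Z)"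

lemma pr1_iff: "pr1 x = a \<longleftrightarrow> (\<exists>b. x = pr a b) \<or> \<not> is_pr x \<and> a = Z"
proof -
  have "\<exists>!a. (\<exists>b. x = pr a b) \<or> \<not> is_pr x \<and> a = Z" by (auto simp: is_pr_def)
  from theI'[OF this] the1_equality[OF this, of a] show ?thesis
    unfolding pr1_def[symmetric] by (intro iffI) (simp_all only:)
qed

lemma pr2_iff: "pr2 x = b \<longleftrightarrow> (\<exists>a. x = pr a b) \<or> \<not> is_pr x \<and> b = Z"
proof -
  have "\<exists>!b. (\<exists>a. x = pr a b) \<or> \<not> is_pr x \<and> b = Z" by (auto simp: is_pr_def)
  from theI'[OF this] the1_equality[OF this, of b] show ?thesis
    unfolding pr2_def[symmetric] by (intro iffI) (simp_all only:)
qed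

text \<open>Projections are not terms of the language, so functions are handled through their
  graphs.\<close>

definition arith_fun :: "('a \<Rightarrow> 'a) \<Rightarrow> bool" where
  "arith_fun F \<longleftrightarrow> arith_pred (\<lambda>e. F (e 0) = e 1)"

lemma arith_fun_app: "arith_fun F \<Longrightarrow> pos_term f \<Longrightarrow> pos_term g \<Longrightarrow> arith_pred (\<lambda>e. F (f e) = g e)"
  using arith_pred_app2[of "\<lambda>x y. F x = y" f g] by (simp add: arith_fun_def)

lemma arith_fun_pr1: "arith_fun pr1"
  unfolding arith_fun_def pr1_iff is_pr_def by (intro pos_intros pos_term_pr)

lemma arith_fun_pr2: "arith_fun pr2"
  unfolding arith_fun_def pr2_iff is_pr_def by (intro pos_intros pos_term_pr)

lemma arith_fun_comp:
  assumes "arith_fun F" and "arith_fun G"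
  shows "arith_fun (\<lambda>x. F (G x))"
proof -
  have "arith_pred (\<lambda>e. \<exists>u. G (e 0) = u \<and> F u = e 1)"
    by (intro pos_intros arith_fun_app assms)
  then show ?thesis by (simp add: arith_fun_def)
qed

lemma arith_pred_fun2:
  assumes "arith_fun F" and "arith_fun G" and "arith_pred (\<lambda>e. R (e 0) (e 1))"
  shows "arith_pred (\<lambda>e. R (F (e 0)) (G (e 1)))"
proof -
  have "arith_pred (\<lambda>e. \<exists>u v. F (e 0) = u \<and> G (e 1) = v \<and> R u v)"
    by (intro pos_intros arith_fun_app arith_pred_app2[OF assms(3)] assms(1,2))
  then show ?thesis by simp
qed

text \<open>
  An element of the model codes an environment by iterated pairing, so that prepending a value is
  pairing with it.
\<close>

definition dec :: "'a \<Rightarrow> nat \<Rightarrow> 'a" where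
  "dec x i = pr1 ((pr2 ^^ i) x)"

lemma dec_pr: "dec (pr n x) = case_nat n (dec x)"
proof
  fix i
  have "pr1 (pr n x) = n" "pr2 (pr n x) = x"
    by (auto simp: pr1_iff pr2_iff)
  then show "dec (pr n x) i = case_nat n (dec x) i"
    by (cases i) (simp_all add: dec_def funpow_swap1[symmetric] del: funpow.simps(2)
      add: funpow_Suc_right)
qed

text \<open>The induction on \<open>k\<close> is in the metatheory: only a standard number of
  positions is prescribed, enough for the variables of one formula.\<close>

lemma dec_exists: "\<exists>x. \<forall>i<k. dec x i = e i"
proof (induction k arbitrary: e)
  case (Suc k)
  obtain x where "\<forall>i<k. dec x i = e (Suc i)" using Suc[of "\<lambda>i. e (Suc i)"] by blast
  then have "\<forall>i<Suc k. dec (pr (e 0) x) i = e i"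
    by (auto simp: dec_pr split: nat.split)
  then show ?case by blast
qed simp

lemma arith_fun_eval: "arith_fun (\<lambda>x. eval M (dec x) t)"
proof (induction t)
  case (Var i)
  have "arith_fun (pr2 ^^ i)"
  proof (induction i)
    case 0
    show ?case by (simp add: arith_fun_def pos_intros)
  next
    case (Suc i)
    show ?case using arith_fun_comp[OF arith_fun_pr2 Suc] by (simp add: comp_def)
  qed
  from arith_fun_comp[OF arith_fun_pr1 this] show ?case by (simp add: dec_def)
next
  case Zero
  show ?case by (simp add: arith_fun_def pos_intros)
next
  case (Succ t)
  have "arith_pred (\<lambda>e. \<exists>u. eval M (dec (e 0)) t = u \<and> S u = e 1)"
    by (intro pos_intros arith_fun_app[OF Succ])
  then show ?case by (simp add: arith_fun_def)
next
  case (Add s t)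
  have "arith_pred (\<lambda>e. \<exists>u v. eval M (dec (e 0)) s = u \<and> eval M (dec (e 0)) t = v \<and> u \<oplus> v = e 1)"
    by (intro pos_intros arith_fun_app[OF Add.IH(1)] arith_fun_app[OF Add.IH(2)])
  then show ?case by (simp add: arith_fun_def)
next
  case (Mul s t)
  have "arith_pred (\<lambda>e. \<exists>u v. eval M (dec (e 0)) s = u \<and> eval M (dec (e 0)) t = v \<and> u \<otimes> v = e 1)"
    by (intro pos_intros arith_fun_app[OF Mul.IH(1)] arith_fun_app[OF Mul.IH(2)])
  then show ?case by (simp add: arith_fun_def)
qed

lemma arith_pred_eval_eq:
  "pos_term f \<Longrightarrow> pos_term g \<Longrightarrow>
    arith_pred (\<lambda>e. eval M (dec (f e)) s = eval M (dec (g e)) t)"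
  by (rule arith_pred_app2[OF arith_pred_fun2[OF arith_fun_eval arith_fun_eval]])
    (intro pos_intros)

lemma arith_pred_eval_ls:
  "pos_term f \<Longrightarrow> pos_term g \<Longrightarrow>
    arith_pred (\<lambda>e. ls M (eval M (dec (f e)) s) (eval M (dec (g e)) t))"
  by (rule arith_pred_app2[OF arith_pred_fun2[OF arith_fun_eval arith_fun_eval]])
    (intro pos_intros)

definition def_sets :: "'a set set" where
  "def_sets = {X. def_pred (\<lambda>e. e 0 \<in> X)}"

text \<open>Recursion on the fixed formula \<open>A\<close> outside the model; a number quantifier
  becomes a quantifier over the element paired onto the code.\<close>

lemma def_pred_sat2_dec:
  assumes "\<And>X. V X \<in> def_sets"
  shows "arithmetical A \<Longrightarrow> def_pred (\<lambda>e. sat2 M \<S> (dec (e 0)) V A)"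
proof -
  have eval: "def_pred (\<lambda>e. eval M (dec (e (Suc 0))) t = e 0)" for t
    by (intro def_pred_arith arith_fun_app[OF arith_fun_eval] pos_term_var)
  note V = def_pred_app1[OF assms[unfolded def_sets_def mem_Collect_eq]]
  show "arithmetical A \<Longrightarrow> def_pred (\<lambda>e. sat2 M \<S> (dec (e 0)) V A)"
  proof (induction A)
    case (Forall2 A)
    then have IH: "def_pred (\<lambda>e. sat2 M \<S> (dec (e 0)) V A)" by simp
    have "def_pred (\<lambda>e. \<forall>n. sat2 M \<S> (dec (pr n (e 0))) V A)"
      by (intro def_intros def_term_pr def_pred_app1[OF IH])
    then show ?case by (simp add: dec_pr)
  next
    case (Exists2 A)
    then have IH: "def_pred (\<lambda>e. sat2 M \<S> (dec (e 0)) V A)" by simp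
    have "def_pred (\<lambda>e. \<exists>n. sat2 M \<S> (dec (pr n (e 0))) V A)"
      by (intro def_intros def_term_pr def_pred_app1[OF IH])
    then show ?case by (simp add: dec_pr)
  next
    case (Mem t X)
    have "def_pred (\<lambda>e. \<exists>u. eval M (dec (e 0)) t = u \<and> u \<in> V X)"
      by (intro def_pred_ex def_pred_conj eval V def_term_var)
    then show ?case by simp
  next
    case (NMem t X)
    have "def_pred (\<lambda>e. \<exists>u. eval M (dec (e 0)) t = u \<and> u \<notin> V X)"
      by (intro def_pred_ex def_pred_conj def_pred_not eval V def_term_var)
    then show ?case by simp
  qed (simp_all add: def_pred_conj def_pred_disj def_pred_not def_pred_arith arith_pred_eval_eq
        arith_pred_eval_ls pos_term_var)
qed

section \<open>The refutation calculus for arithmetical formulas\<close>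

definition all_step :: "fm2 \<Rightarrow> 'a \<Rightarrow> 'a \<Rightarrow> bool" where
  "all_step C x r \<longleftrightarrow>
    (case C of Conj2 A B \<Rightarrow> r = ob A x \<or> r = ob B x | Forall2 A \<Rightarrow> \<exists>n. r = ob A (pr n x) | _ \<Rightarrow> False)"

definition any_step :: "fm2 \<Rightarrow> 'a \<Rightarrow> 'a \<Rightarrow> bool" where
  "any_step C x r \<longleftrightarrow>
    (case C of Disj2 A B \<Rightarrow> r = ob A x \<or> r = ob B x | Exists2 A \<Rightarrow> \<exists>n. r = ob A (pr n x) | _ \<Rightarrow> False)"

definition disjunctive :: "fm2 \<Rightarrow> bool" where
  "disjunctive C \<longleftrightarrow> (case C of Disj2 A B \<Rightarrow> True | Exists2 A \<Rightarrow> True | _ \<Rightarrow> False)"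

definition false_literal :: "fm2 \<Rightarrow> 'a \<Rightarrow> bool" where
  "false_literal C x \<longleftrightarrow> (case C of
     Eq2 s t \<Rightarrow> eval M (dec x) s \<noteq> eval M (dec x) t
   | Neq2 s t \<Rightarrow> eval M (dec x) s = eval M (dec x) t
   | Less2 s t \<Rightarrow> \<not> ls M (eval M (dec x) s) (eval M (dec x) t)
   | NLess2 s t \<Rightarrow> ls M (eval M (dec x) s) (eval M (dec x) t)
   | _ \<Rightarrow> False)"

text \<open>Values are compared, not terms, as the two obligations carry different environments.
  Comparing them suffices because the formulas concerned have 0 as their only set variable.\<close>

definition clash :: "fm2 \<Rightarrow> 'a \<Rightarrow> fm2 \<Rightarrow> 'a \<Rightarrow> bool" where
  "clash C x D y \<longleftrightarrow> (case C of
     Mem s _ \<Rightarrow> (case D of NMem t _ \<Rightarrow> eval M (dec x) s = eval M (dec y) t | _ \<Rightarrow> False)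
   | _ \<Rightarrow> False)"

lemma all_step_not_disjunctive: "all_step C x r \<Longrightarrow> \<not> disjunctive C"
  by (cases C) (simp_all add: all_step_def disjunctive_def)

lemma arith_pred_all_step: "pos_term f \<Longrightarrow> pos_term g \<Longrightarrow> arith_pred (\<lambda>e. all_step C (f e) (g e))"
  by (rule arith_pred_app2, cases C)
    (simp_all add: all_step_def arith_pred_const, (intro pos_intros pos_term_ob pos_term_pr)+)

lemma arith_pred_any_step: "pos_term f \<Longrightarrow> pos_term g \<Longrightarrow> arith_pred (\<lambda>e. any_step C (f e) (g e))"
  by (rule arith_pred_app2, cases C)
    (simp_all add: any_step_def arith_pred_const, (intro pos_intros pos_term_ob pos_term_pr)+)

lemma arith_pred_false_literal: "pos_term f \<Longrightarrow> arith_pred (\<lambda>e. false_literal C (f e))"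
  by (cases C) (simp_all add: false_literal_def arith_pred_const arith_pred_not arith_pred_eval_eq
    arith_pred_eval_ls)

lemma arith_pred_clash: "pos_term f \<Longrightarrow> pos_term g \<Longrightarrow> arith_pred (\<lambda>e. clash C (f e) D (g e))"
  by (cases C; cases D) (simp_all add: clash_def arith_pred_const arith_pred_eval_eq)

text \<open>The set quantifier is traded for irrefutability of the one-element list
  \<open>pr (ob B x) Z\<close>, which is definable from a single \<open>I\<close>. As 0 is the only
  set variable of \<open>B\<close>, the valuation \<open>V\<close> merely fills the other
  indices.\<close>

lemma Sigma11_definable:
  assumes B: "arithmetical B" "fvs2 B \<subseteq> {0}" and V: "\<And>X. V X \<in> def_sets"
  shows "def_pred (\<lambda>e. \<exists>X\<in>def_sets. sat2 M def_sets (dec (e 0)) (case_nat X V) B)"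
proof -
  \<comment> \<open>A false literal conflicts with every \<open>m'\<close>, in particular with
    itself.\<close>
  define Con where "Con m m' \<longleftrightarrow> (\<exists>C\<in>sub B. \<exists>x. m = ob C x \<and> false_literal C x) \<or>
    (\<exists>C\<in>sub B. \<exists>D\<in>sub B. \<exists>x y. m = ob C x \<and> m' = ob D y \<and> clash C x D y)" for m m'
  define All where "All m r \<longleftrightarrow> (\<exists>C\<in>sub B. \<exists>x. m = ob C x \<and> all_step C x r)" for m r
  define Any where "Any m r \<longleftrightarrow> (\<exists>C\<in>sub B. \<exists>x. m = ob C x \<and> any_step C x r)" for m r
  define Dis where "Dis m \<longleftrightarrow> (\<exists>C\<in>sub B. \<exists>x. m = ob C x \<and> disjunctive C)" for m
  interpret obligations M P nm Con All Any Dis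
  proof
    note rules = pos_intros arith_pred_finite_ex finite_sub pos_term_ob
    show "arith_pred (\<lambda>e. Con (e 0) (e 1))"
      unfolding Con_def by (intro rules arith_pred_false_literal arith_pred_clash)
    show "arith_pred (\<lambda>e. All (e 0) (e 1))"
      unfolding All_def by (intro rules arith_pred_all_step)
    show "arith_pred (\<lambda>e. Any (e 0) (e 1))"
      unfolding Any_def by (intro rules arith_pred_any_step)
    show "arith_pred (\<lambda>e. Dis (e 0))"
      unfolding Dis_def by (intro rules)
    show "\<not> Dis m" if "All m r" for m r
      using that all_step_not_disjunctive by (auto simp: All_def Dis_def)
  qed
  have sub: "arithmetical C \<and> fvs2 C \<subseteq> {0}" if "C \<in> sub B" for C
    using arithmetical_sub[OF B(1) that] B(2) by blast
  have "(\<exists>X\<in>def_sets. sat2 M def_sets (dec x) (case_nat X V) B) \<longleftrightarrow> \<not> refutable (pr (ob B x) Z)" for x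
  proof
    assume "\<exists>X\<in>def_sets. sat2 M def_sets (dec x) (case_nat X V) B"
    then obtain X where X: "X \<in> def_sets" and sat: "sat2 M def_sets (dec x) (case_nat X V) B"
      by blast
    have V': "case_nat X V i \<in> def_sets" for i using X V by (simp split: nat.split)
    \<comment> \<open>The obligations that are true for \<open>X\<close>: truth is a saturated and
      conflict-free choice.\<close>
    define W where "W = {m. \<exists>C\<in>sub B. \<exists>y. m = ob C y \<and> sat2 M def_sets (dec y) (case_nat X V) C}"
    show "\<not> refutable (pr (ob B x) Z)"
    proof (rule not_refutable_if_hintikka)
      show "ob B x \<in> W" using sat sub_refl by (auto simp: W_def)
      show "def_pred (\<lambda>e. e 0 \<in> W)"
        unfolding W_def mem_Collect_eq
        by (intro def_pred_finite_ex finite_sub def_intros def_term_ob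
            def_pred_app1[OF def_pred_sat2_dec[OF V']]) (use sub in blast)
      show "hintikka W"
        unfolding hintikka_def
      proof (intro ballI conjI allI impI)
        fix m m' assume "m \<in> W" "m' \<in> W"
        then obtain C y D z where C: "m = ob C y" "sat2 M def_sets (dec y) (case_nat X V) C" "C \<in> sub B"
          and D: "m' = ob D z" "sat2 M def_sets (dec z) (case_nat X V) D" "D \<in> sub B"
          by (auto simp: W_def)
        have "\<not> false_literal C y"
          using C(2) by (cases C) (simp_all add: false_literal_def)
        moreover have "\<not> clash C y D z"
          using C(2) D(2) sub[OF C(3)] sub[OF D(3)] by (cases C; cases D) (auto simp: clash_def)
        ultimately show "\<not> Con m m'" using C(1) D(1) by (auto simp: Con_def)
      next
        fix m r assume "m \<in> W" "All m r"
        then obtain C y where C: "m = ob C y" "sat2 M def_sets (dec y) (case_nat X V) C" "C \<in> sub B"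
          "all_step C y r"
          by (auto simp: W_def All_def)
        then show "r \<in> W"
          by (cases C) (auto simp: all_step_def W_def dec_pr dest: sub_Conj2 sub_Forall2)
      next
        fix m assume "m \<in> W" "Dis m"
        then obtain C y where C: "m = ob C y" "sat2 M def_sets (dec y) (case_nat X V) C" "C \<in> sub B"
          "disjunctive C"
          by (auto simp: W_def Dis_def)
        have "\<exists>r\<in>W. any_step C y r"
        proof (cases C)
          case (Disj2 D E)
          then show ?thesis using C sub_Disj2[of D E B]
            by (auto simp: any_step_def W_def)
        next
          case (Exists2 D)
          then obtain n where "sat2 M def_sets (dec (pr n y)) (case_nat X V) D"
            using C(2) by (auto simp: dec_pr)
          then have "ob D (pr n y) \<in> W" using C(3) Exists2 sub_Exists2 by (auto simp: W_def)
          then show ?thesis using Exists2 by (auto simp: any_step_def)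
        qed (use C(4) in \<open>simp_all add: disjunctive_def\<close>)
        then show "\<exists>r\<in>W. Any m r" using C by (auto simp: Any_def)
      qed
    qed
  next
    assume "\<not> refutable (pr (ob B x) Z)"
    then obtain W where W: "hintikka W" "def_pred (\<lambda>e. e 0 \<in> W)" "ob B x \<in> W"
      by (rule hintikka_if_not_refutable)
    \<comment> \<open>The smallest set that meets all positive membership obligations in
      \<open>W\<close>; a negative one cannot be violated, as that would be a clash within
      \<open>W\<close>.\<close>
    define X where "X = {v. \<exists>C\<in>sub B. \<exists>y. ob C y \<in> W \<and>
      (case C of Mem t _ \<Rightarrow> eval M (dec y) t = v | _ \<Rightarrow> False)}"
    have "def_pred (\<lambda>e. case C of Mem t _ \<Rightarrow> eval M (dec (e 0)) t = e 1 | _ \<Rightarrow> False)" for C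
      by (cases C) (simp_all add: def_pred_const def_pred_arith arith_fun_app[OF arith_fun_eval] pos_term_var)
    note def_val = def_pred_app2[where R = "\<lambda>y v. case C of Mem t _ \<Rightarrow> eval M (dec y) t = v | _ \<Rightarrow> False" for C, OF this]
    have X: "X \<in> def_sets"
      unfolding def_sets_def X_def mem_Collect_eq
      by (intro def_pred_finite_ex finite_sub def_intros def_pred_app1[OF W(2)] def_term_ob def_val)
    have "sat2 M def_sets (dec y) (case_nat X V) C" if "C \<in> sub B" "ob C y \<in> W" for C y
      using that
    proof (induction C arbitrary: y)
      case (Mem t i)
      then show ?case using sub[OF Mem(1)] by (auto simp: X_def intro!: bexI[of _ "Mem t i"])
    next
      case (NMem t i)
      have "eval M (dec y) t \<notin> X"
      proof
        assume "eval M (dec y) t \<in> X"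
        then obtain C z where C: "C \<in> sub B" "ob C z \<in> W"
          and val: "case C of Mem s _ \<Rightarrow> eval M (dec z) s = eval M (dec y) t | _ \<Rightarrow> False"
          by (auto simp: X_def)
        have "clash C z (NMem t i) y" using val by (cases C) (simp_all add: clash_def)
        then have "Con (ob C z) (ob (NMem t i) y)" using NMem(1) C(1) unfolding Con_def by blast
        then show False using W(1) C(2) NMem(2) unfolding hintikka_def by blast
      qed
      then show ?case using sub[OF NMem(1)] by simp
    next
      case (Conj2 D E)
      have "All (ob (Conj2 D E) y) (ob D y)" "All (ob (Conj2 D E) y) (ob E y)"
        using Conj2.prems(1) by (auto simp: All_def all_step_def)
      then have "ob D y \<in> W" "ob E y \<in> W" using W(1) Conj2.prems(2) unfolding hintikka_def by blast+
      then show ?case using Conj2.IH sub_Conj2[OF Conj2.prems(1)] by simp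
    next
      case (Forall2 D)
      have "All (ob (Forall2 D) y) (ob D (pr n y))" for n
        using Forall2.prems(1) by (auto simp: All_def all_step_def)
      then have "ob D (pr n y) \<in> W" for n
        using W(1) Forall2.prems(2) unfolding hintikka_def by blast
      then have "sat2 M def_sets (dec (pr n y)) (case_nat X V) D" for n
        using Forall2.IH sub_Forall2[OF Forall2.prems(1)] by blast
      then show ?case by (simp add: dec_pr)
    next
      case (Disj2 D E)
      have "Dis (ob (Disj2 D E) y)" using Disj2.prems(1) by (auto simp: Dis_def disjunctive_def)
      then obtain r where "r \<in> W" "Any (ob (Disj2 D E) y) r"
        using W(1) Disj2.prems(2) unfolding hintikka_def by blast
      then have "ob D y \<in> W \<or> ob E y \<in> W" by (auto simp: Any_def any_step_def)
      then show ?case using Disj2.IH sub_Disj2[OF Disj2.prems(1)] by auto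
    next
      case (Exists2 D)
      have "Dis (ob (Exists2 D) y)" using Exists2.prems(1) by (auto simp: Dis_def disjunctive_def)
      then obtain r where "r \<in> W" "Any (ob (Exists2 D) y) r"
        using W(1) Exists2.prems(2) unfolding hintikka_def by blast
      then obtain n where "ob D (pr n y) \<in> W" by (auto simp: Any_def any_step_def)
      then have "sat2 M def_sets (dec (pr n y)) (case_nat X V) D"
        using Exists2.IH sub_Exists2[OF Exists2.prems(1)] by blast
      then show ?case by (auto simp: dec_pr)
    next
      case (ForallS D)
      then show ?case using sub by fastforce
    next
      case (ExistsS D)
      then show ?case using sub by fastforce
    next
      case (Eq2 s t)
      then have "\<not> Con (ob (Eq2 s t) y) (ob (Eq2 s t) y)" using W(1) unfolding hintikka_def by blast
      then show ?case using Eq2(1) by (auto simp: Con_def false_literal_def)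
    next
      case (Neq2 s t)
      then have "\<not> Con (ob (Neq2 s t) y) (ob (Neq2 s t) y)" using W(1) unfolding hintikka_def by blast
      then show ?case using Neq2(1) by (auto simp: Con_def false_literal_def)
    next
      case (Less2 s t)
      then have "\<not> Con (ob (Less2 s t) y) (ob (Less2 s t) y)" using W(1) unfolding hintikka_def by blast
      then show ?case using Less2(1) by (auto simp: Con_def false_literal_def)
    next
      case (NLess2 s t)
      then have "\<not> Con (ob (NLess2 s t) y) (ob (NLess2 s t) y)" using W(1) unfolding hintikka_def by blast
      then show ?case using NLess2(1) by (auto simp: Con_def false_literal_def)
    qed
    then have "sat2 M def_sets (dec x) (case_nat X V) B" using W(3) sub_refl by blast
    then show "\<exists>X\<in>def_sets. sat2 M def_sets (dec x) (case_nat X V) B" using X by blast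
  qed
  then show ?thesis
    by (simp add: def_pred_not def_pred_refutable def_term_pr def_term_ob def_term_const def_term_var)
qed

section \<open>The second order model of definable sets\<close>

text \<open>\<open>A\<close> has finitely many free variables, so its number parameters fit into one
  code \<open>c\<close>, uniformly in \<open>x\<close> and in the set valuation.\<close>

lemma env_code:
  assumes "arithmetical A"
  obtains c where "\<And>x V. sat2 M \<S> (case_nat x e) V A \<longleftrightarrow> sat2 M \<S> (dec (pr x c)) V A"
proof -
  obtain k where k: "\<And>i. i \<in> fvn2 A \<Longrightarrow> i < k"
    using finite_nat_set_iff_bounded[of "fvn2 A"] by auto
  obtain c where c: "\<forall>i<k. dec c i = e i" using dec_exists by blast
  have "sat2 M \<S> (case_nat x e) V A \<longleftrightarrow> sat2 M \<S> (dec (pr x c)) V A" for x V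
    by (rule sat2_cong[OF assms]) (use k c in \<open>fastforce simp: dec_pr split: nat.split\<close>)
  then show thesis by (rule that)
qed

lemma arithmetical_comprehension:
  assumes "arithmetical A" and V: "\<And>X. V X \<in> def_sets"
  shows "{x. sat2 M \<S> (case_nat x e) V A} \<in> def_sets"
proof -
  obtain c where "\<And>x V. sat2 M \<S> (case_nat x e) V A \<longleftrightarrow> sat2 M \<S> (dec (pr x c)) V A"
    using env_code[OF assms(1)] by blast
  then show ?thesis
    unfolding def_sets_def mem_Collect_eq
    using def_pred_app1[where R = "\<lambda>x. sat2 M \<S> (dec x) V A", OF def_pred_sat2_dec[OF V assms(1)]
        def_term_pr[OF def_term_var def_term_const]]
    by simp
qed

text \<open>Complement of the existential case for \<open>neg2 B\<close>, with the number parameters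
  from \<open>e\<close> absorbed into a code \<open>c\<close>.\<close>

lemma Pi11_comprehension:
  assumes "arithmetical B" and "fvs2 B \<subseteq> {0}" and V: "\<And>X. V X \<in> def_sets"
  shows "{x. \<forall>X\<in>def_sets. sat2 M def_sets (case_nat x e) (case_nat X V) B} \<in> def_sets"
proof -
  have B: "arithmetical (neg2 B)" "fvs2 (neg2 B) \<subseteq> {0}" using assms by simp_all
  obtain c where c: "\<And>x V. sat2 M def_sets (case_nat x e) V (neg2 B)
      \<longleftrightarrow> sat2 M def_sets (dec (pr x c)) V (neg2 B)"
    using env_code[OF B(1)] by blast
  have "def_pred (\<lambda>e. \<not> (\<exists>X\<in>def_sets. sat2 M def_sets (dec (pr (e 0) c)) (case_nat X V) (neg2 B)))"
    by (rule def_pred_not, rule def_pred_app1[OF Sigma11_definable[OF B V]])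
      (intro def_term_pr def_intros)
  then have "def_pred (\<lambda>e'. \<forall>X\<in>def_sets. sat2 M def_sets (case_nat (e' 0) e) (case_nat X V) B)"
    using c by simp
  then show ?thesis by (subst def_sets_def) simp
qed

lemma sat2_set_induction:
  assumes "\<And>X. V X \<in> def_sets"
  shows "sat2 M \<S> e V set_induction"
  using induct[of "\<lambda>x. x \<in> V 0"] assms[of 0] by (auto simp: set_induction_def def_sets_def)

lemma sat2_arith_axioms:
  assumes "A \<in> arith_axioms"
  shows "sat2 M \<S> e V (to_fm2 (\<lambda>_ :: unit. 0) A)"
proof -
  have "\<forall>A\<in>arith_axioms. sat M P e A" using arith by blast
  \<comment> \<open>The axioms contain no predicate symbol, so the interpretation and even the type
    of the symbols can be exchanged.\<close>
  then have "\<forall>A\<in>arith_axioms. sat M (\<lambda>(_ :: unit) x. x \<in> V 0) e A"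
    by (simp add: arith_axioms_def)
  then show ?thesis using assms by (simp add: sat2_to_fm2)
qed

lemma sat2_comprehension:
  assumes "{x. sat2 M \<S> (case_nat x e) V A} \<in> \<S>"
  shows "sat2 M \<S> e V (comprehension A)"
  unfolding comprehension_def sat2.simps by (rule bexI[OF _ assms]) simp

lemma sat2_Pi11_CA0_minus:
  assumes "A \<in> Pi11_CA0_minus" and "\<And>X. V X \<in> def_sets"
  shows "sat2 M def_sets e V A"
proof -
  consider (arith) B where "A = univ_closure2 (to_fm2 (\<lambda>_ :: unit. 0) B)" "B \<in> arith_axioms"
    | (ind) "A = univ_closure2 set_induction"
    | (ACA) B where "A = univ_closure2 (comprehension B)" "arithmetical B"
    | (Pi11) B where "A = univ_closure2 (comprehension (ForallS B))" "arithmetical B"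
      "fvs2 (ForallS B) = {}"
    using assms(1) unfolding Pi11_CA0_minus_def ACA0_def Pi11_def by blast
  then show ?thesis
  proof cases
    case arith
    then show ?thesis using assms(2) by (auto intro!: sat2_univ_closure2 sat2_arith_axioms)
  next
    case ind
    then show ?thesis using assms(2) by (auto intro!: sat2_univ_closure2 sat2_set_induction)
  next
    case ACA
    then show ?thesis using assms(2)
      by (auto intro!: sat2_univ_closure2 sat2_comprehension arithmetical_comprehension)
  next
    case Pi11
    \<comment> \<open>Any index \<open>Suc i\<close> free in \<open>B\<close> would be the free set
      variable \<open>i\<close> of \<open>ForallS B\<close>.\<close>
    have "fvs2 B \<subseteq> {0}"
    proof
      fix i assume "i \<in> fvs2 B"
      then show "i \<in> {0}" using Pi11(3) by (cases i) auto
    qed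
    then have "sat2 M def_sets e V (comprehension (ForallS B))" if "\<And>X. V X \<in> def_sets" for e V
      using Pi11_comprehension[OF Pi11(2) _ that] by (intro sat2_comprehension) simp
    then show ?thesis unfolding Pi11(1) using assms(2) by (rule sat2_univ_closure2)
  qed
qed

text \<open>From left to right, (L) applies to each closed \<open>X\<close> because it is definable.
  From right to left, the extension of \<open>P \<phi>\<close> is itself among the definable sets
  and closed by (F).\<close>

lemma sat2_LF:
  assumes "V Y = {x. P \<phi> x}"
  shows "sat2 M def_sets e V (LF \<phi> Y)"
proof -
  have "fv (form_of \<phi>) \<subseteq> {0}" using form_of[of \<phi>] by auto
  then have form: "sat M (\<lambda>_ x. x \<in> X) (case_nat z e') (form_of \<phi>)
      \<longleftrightarrow> sat M (\<lambda>_ x. x \<in> X) (\<lambda>_. z) (form_of \<phi>)" for X z e'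
    by (intro sat_cong) auto
  have "P \<phi> x \<longleftrightarrow> (\<forall>X\<in>def_sets.
      (\<forall>z. sat M (\<lambda>_ x. x \<in> X) (\<lambda>_. z) (form_of \<phi>) \<longrightarrow> z \<in> X) \<longrightarrow> x \<in> X)" for x
  proof (intro iffI ballI impI)
    fix X assume x: "P \<phi> x" and X: "X \<in> def_sets"
      and cl: "\<forall>z. sat M (\<lambda>_ x. x \<in> X) (\<lambda>_. z) (form_of \<phi>) \<longrightarrow> z \<in> X"
    show "x \<in> X"
    proof (rule P_least[of "\<lambda>x. x \<in> X"])
      show "def_pred (\<lambda>e. e 0 \<in> X)" using X by (simp add: def_sets_def)
      show "z \<in> X" if "sat M (\<lambda>_ x. x \<in> X) (\<lambda>_. z) (form_of \<phi>)" for z using cl that by blast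
    qed (rule x)
  next
    assume *: "\<forall>X\<in>def_sets.
      (\<forall>z. sat M (\<lambda>_ x. x \<in> X) (\<lambda>_. z) (form_of \<phi>) \<longrightarrow> z \<in> X) \<longrightarrow> x \<in> X"
    have "{x. P \<phi> x} \<in> def_sets"
      unfolding def_sets_def mem_Collect_eq by (intro def_intros)
    from bspec[OF * this] show "P \<phi> x" using P_closed[of \<phi>] by simp
  qed
  then show ?thesis by (simp add: LF_def Cl_def sat2_to_fm2 form assms)
qed

end

theorem theorem4p5:
  fixes Y :: "opform \<Rightarrow> nat" and \<psi> :: id_fm
  assumes "inj Y"
    and "provable2 (Pi11_CA0_minus \<union> {LF \<phi> (Y \<phi>) | \<phi>. True}) (star Y \<psi>)"
  shows "provable ID1 \<psi>"
proof (rule ccontr)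
  assume "\<not> provable ID1 \<psi>"
  then obtain M :: "nat arith" and P e where
    M: "\<forall>A\<in>arith_axioms \<union> range induction_axiom \<union> range fixpoint_axiom
           \<union> {least_axiom \<phi> \<psi> | \<phi> \<psi>. True}. \<forall>e. sat M P e A"
    and \<psi>: "\<not> sat M P e \<psi>"
    unfolding ID1_def using completeness by blast
  interpret id_model M P id
    by unfold_locales (use M in auto)
  \<comment> \<open>Injectivity of \<open>Y\<close> assigns each set variable to at most one
    operator form; the remaining variables get the empty set, which is definable.\<close>
  define V where "V X = (if X \<in> range Y then {x. P (inv Y X) x} else {})" for X
  have V_Y: "V (Y \<phi>) = {x. P \<phi> x}" for \<phi>
    using assms(1) by (simp add: V_def)
  have V: "V X \<in> def_sets" for X
    by (cases "X \<in> range Y")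
      (simp_all add: V_def def_sets_def def_pred_P def_term_var def_pred_const)
  obtain \<Gamma> where \<Gamma>: "\<Gamma> \<subseteq> Pi11_CA0_minus \<union> {LF \<phi> (Y \<phi>) | \<phi>. True}"
    "tait2 (insert (star Y \<psi>) (neg2 ` \<Gamma>))"
    using assms(2) by (auto simp: provable2_def)
  have "sat2 M def_sets e V A" if A: "A \<in> \<Gamma>" for A
  proof -
    consider "A \<in> Pi11_CA0_minus" | \<phi> where "A = LF \<phi> (Y \<phi>)" using A \<Gamma>(1) by blast
    then show ?thesis using V V_Y by cases (simp_all add: sat2_Pi11_CA0_minus sat2_LF)
  qed
  then have "sat2 M def_sets e V (star Y \<psi>)"
    using tait2_sound[OF \<Gamma>(2), of V def_sets M e] V by auto
  then have "sat M P e \<psi>" by (simp add: sat2_to_fm2 V_Y)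
  with \<psi> show False by contradiction
qed

end
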